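(* Let $\Omega\subset\subset\mathbb{C}^n$ ($n\ge2$) be a pseudoconvex domain with smooth boundary. For a smooth defining function $\rho$ of $\Omega$ and a $(1,0)$ tangent vector field $L$ on $\partial\Omega$, define $$\Sigma_L:=\{p\in\partial\Omega:\mathcal{L}_\rho(L,L)(p)=0\}.$$ For each smooth defining function $\rho$ of $\Omega$, let $\eta_\rho$ be the infimum of all $\eta_2\in(1,\infty)$ satisfying $$\frac{1}{\eta_2-1}\frac{|\mathcal{L}_\rho(L,N)|^2}{\|\nabla\rho\|^2}-\frac12\frac{N\mathcal{L}_\rho(L,L)}{\|\nabla\rho\|}\le0$$ on $\Sigma_L$ for all $(1,0)$ tangent vector fields $L$ on $\partial\Omega$, where $N=N_\rho$ and $L$ is extended to $U$ so that $L\rho=0$ on $U$. Then $$S(\Omega)=\inf\eta_\rho,$$ where the infimum is taken over all smooth defining functions $\rho$ of $\Omega$.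
   Context: Smooth means $C^\infty$. A (global) defining function of $\Omega$ is a smooth real function $\rho$ on a neighborhood $V$ of $\overline\Omega$ with $\Omega=\{z\in V:\rho(z)<0\}$ and $d\rho\neq0$ on $\partial\Omega$. Steinness index: with $\overline\Omega^{\complement}=\mathbb{C}^n\setminus\overline\Omega$, $\widetilde\eta_\rho:=\inf\{\widetilde\eta>1: \rho^{\widetilde\eta}\text{ is strictly plurisubharmonic on }\overline\Omega^{\complement}\cap U'\text{ for some neighborhood }U'\text{ of }\partial\Omega\}$ (and $\widetilde\eta_\rho=\infty$ if there is no such $\widetilde\eta$); $S(\Omega):=\inf_\rho\widetilde\eta_\rho$ over all defining functions $\rho$ of $\Omega$. $U$ is a (sufficiently small) tubular neighborhood of $\partial\Omega$, on which $\rho$ is defined and $d\rho\ne0$. $\nabla\rho$ is the real gradient of $\rho$ and $\|\nabla\rho\|$ its Euclidean norm, so $\|\nabla\rho\|=2\sqrt{\sum_j|\partial\rho/\partial z_j|^2}$. $$N_\rho:=\frac{1}{\sqrt{\sum_{j=1}^n|\partial\rho/\partial z_j|^2}}\sum_{j=1}^n\frac{\partial\rho}{\partial\bar z_j}\frac{\partial}{\partial z_j}.$$ The Levi form of a function $\rho$ on $(1,0)$ vector fields $X=\sum a_j\frac{\partial}{\partial z_j}$, $Y=\sum b_j\frac{\partial}{\partial z_j}$ is $\mathcal{L}_\rho(X,Y)=\sum_{j,k}\frac{\partial^2\rho}{\partial z_j\partial\bar z_k}a_j\overline{b_k}$. A $(1,0)$ tangent vector field on $\partial\Omega$ is a smooth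 section $L$ of $T^{1,0}(\partial\Omega)$, i.e. a $(1,0)$ field with $L\rho=0$ on $\partial\Omega$. $N\mathcal{L}_\rho(L,L)$ denotes the derivative of the function $\mathcal{L}_\rho(L,L)$ along the vector field $N$. The infimum of the empty set is $\infty$. *)

theory Defs
  imports "HOL-Analysis.Analysis"
begin

text \<open>Finite differentiability and smoothness; intended for open \<open>S\<close> in a finite-dimensional
  space, where \<open>C\<^sup>k\<close> can be expressed through iterated directional derivatives.\<close>

primrec Ck_on ::
  "nat \<Rightarrow> ('a::euclidean_space) set \<Rightarrow> ('a \<Rightarrow> 'b::real_normed_vector) \<Rightarrow> bool" where
  "Ck_on 0 S f \<longleftrightarrow> continuous_on S f"
| "Ck_on (Suc k) S f \<longleftrightarrow>
     (\<forall>x\<in>S. f differentiable (at x)) \<and>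
     (\<forall>v. Ck_on k S (\<lambda>x. frechet_derivative f (at x) v))"

definition smooth_on ::
  "('a::euclidean_space) set \<Rightarrow> ('a \<Rightarrow> 'b::real_normed_vector) \<Rightarrow> bool" where
  "smooth_on S f \<longleftrightarrow> (\<forall>k. Ck_on k S f)"

definition gradient :: "('a::euclidean_space \<Rightarrow> real) \<Rightarrow> 'a \<Rightarrow> 'a" where
  "gradient \<rho> z = (\<Sum>b\<in>Basis. frechet_derivative \<rho> (at z) b *\<^sub>R b)"

text \<open>The Wirtinger derivatives \<open>\<partial>f/\<partial>z\<^sub>j = (\<partial>f/\<partial>x\<^sub>j - i \<partial>f/\<partial>y\<^sub>j)/2\<close> and
  \<open>(\<partial>f/\<partial>x\<^sub>j + i \<partial>f/\<partial>y\<^sub>j)/2\<close>: the real directions \<open>x\<^sub>j\<close> and \<open>y\<^sub>j\<close> are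
  \<open>axis j 1\<close> and \<open>axis j \<i>\<close>.\<close>

definition dz :: "'n::finite \<Rightarrow> (complex^'n \<Rightarrow> complex) \<Rightarrow> complex^'n \<Rightarrow> complex" where
  "dz j f z = (frechet_derivative f (at z) (axis j 1)
               - \<i> * frechet_derivative f (at z) (axis j \<i>)) / 2"

definition dzbar :: "'n::finite \<Rightarrow> (complex^'n \<Rightarrow> complex) \<Rightarrow> complex^'n \<Rightarrow> complex" where
  "dzbar j f z = (frechet_derivative f (at z) (axis j 1)
                  + \<i> * frechet_derivative f (at z) (axis j \<i>)) / 2"

abbreviation cpx :: "(complex^'n \<Rightarrow> real) \<Rightarrow> complex^'n \<Rightarrow> complex" where
  "cpx \<rho> \<equiv> \<lambda>z. complex_of_real (\<rho> z)"

text \<open>A \<open>(1,0)\<close> vector \<open>\<Sum>\<^sub>j a\<^sub>j \<partial>/\<partial>z\<^sub>j\<close> is encoded by its coefficient vector \<open>a\<close>, and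
  \<open>vec10 a f z\<close> is its action on \<open>f\<close> at \<open>z\<close>.\<close>

definition vec10 :: "complex^'n::finite \<Rightarrow> (complex^'n \<Rightarrow> complex) \<Rightarrow> complex^'n \<Rightarrow> complex" where
  "vec10 a f z = (\<Sum>j\<in>UNIV. a $ j * dz j f z)"

definition levi ::
  "(complex^'n::finite \<Rightarrow> real) \<Rightarrow> complex^'n \<Rightarrow> complex^'n \<Rightarrow> complex^'n \<Rightarrow> complex" where
  "levi \<rho> z a b = (\<Sum>j\<in>UNIV. \<Sum>k\<in>UNIV. dz j (dzbar k (cpx \<rho>)) z * a $ j * cnj (b $ k))"

definition normal10 :: "(complex^'n::finite \<Rightarrow> real) \<Rightarrow> complex^'n \<Rightarrow> complex^'n" where
  "normal10 \<rho> z = (\<chi> j. dzbar j (cpx \<rho>) z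
                      / complex_of_real (sqrt (\<Sum>k\<in>UNIV. (cmod (dz k (cpx \<rho>) z))\<^sup>2)))"

definition strictly_psh_on :: "(complex^'n::finite) set \<Rightarrow> (complex^'n \<Rightarrow> real) \<Rightarrow> bool" where
  "strictly_psh_on S f \<longleftrightarrow>
     Ck_on 2 S f \<and> (\<forall>z\<in>S. \<forall>a. a \<noteq> 0 \<longrightarrow> 0 < Re (levi f z a a))"

text \<open>Functions are total in HOL; the values of \<open>\<rho>\<close> outside the neighbourhood \<open>V\<close> are
  irrelevant to everything below.\<close>

definition defining_function ::
  "(complex^'n::finite) set \<Rightarrow> (complex^'n \<Rightarrow> real) \<Rightarrow> bool" where
  "defining_function \<Omega> \<rho> \<longleftrightarrow>
     (\<exists>V. open V \<and> closure \<Omega> \<subseteq> V \<and> smooth_on V \<rho> \<and> \<Omega> = {z\<in>V. \<rho> z < 0} \<and>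
          (\<forall>p\<in>frontier \<Omega>. frechet_derivative \<rho> (at p) \<noteq> (\<lambda>_. 0)))"

definition smooth_boundary :: "(complex^'n::finite) set \<Rightarrow> bool" where
  "smooth_boundary \<Omega> \<longleftrightarrow> (\<exists>\<rho>. defining_function \<Omega> \<rho>)"

text \<open>Pseudoconvexity of a smoothly bounded domain, in the sense of Levi. The condition does not
  depend on the choice of the defining function.\<close>

definition pseudoconvex :: "(complex^'n::finite) set \<Rightarrow> bool" where
  "pseudoconvex \<Omega> \<longleftrightarrow>
     (\<exists>\<rho>. defining_function \<Omega> \<rho> \<and>
          (\<forall>p\<in>frontier \<Omega>. \<forall>a. vec10 a (cpx \<rho>) p = 0 \<longrightarrow> 0 \<le> Re (levi \<rho> p a a)))"

text \<open>\<open>Inf {} = \<infinity>\<close> in \<^typ>\<open>ereal\<close>. The neighbourhood \<open>U'\<close> may always be shrunk, so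
  it need not be required to lie in the domain of \<open>\<rho>\<close>.\<close>

definition steinness_exponent ::
  "(complex^'n::finite) set \<Rightarrow> (complex^'n \<Rightarrow> real) \<Rightarrow> ereal" where
  "steinness_exponent \<Omega> \<rho> =
     Inf (ereal ` {\<eta>. 1 < \<eta> \<and>
        (\<exists>U'. open U' \<and> frontier \<Omega> \<subseteq> U' \<and>
              strictly_psh_on (- closure \<Omega> \<inter> U') (\<lambda>z. \<rho> z powr \<eta>))})"

definition steinness_index :: "(complex^'n::finite) set \<Rightarrow> ereal" where
  "steinness_index \<Omega> = (INF \<rho>\<in>{\<rho>. defining_function \<Omega> \<rho>}. steinness_exponent \<Omega> \<rho>)"

definition boundary_nbhd ::
  "(complex^'n::finite) set \<Rightarrow> (complex^'n \<Rightarrow> real) \<Rightarrow> (complex^'n) set \<Rightarrow> bool" where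
  "boundary_nbhd \<Omega> \<rho> U \<longleftrightarrow>
     open U \<and> frontier \<Omega> \<subseteq> U \<and> smooth_on U \<rho> \<and>
     (\<forall>z\<in>U. frechet_derivative \<rho> (at z) \<noteq> (\<lambda>_. 0))"

text \<open>A \<open>(1,0)\<close> tangent vector field on the boundary, given together with an extension to \<open>U\<close>
  that is tangent to the level sets of \<open>\<rho>\<close>. Every smooth section of \<open>T\<^sup>1\<^sup>,\<^sup>0(\<partial>\<Omega>)\<close> is the
  restriction of such a field.\<close>

definition tangent_field ::
  "(complex^'n::finite) set \<Rightarrow> (complex^'n \<Rightarrow> real) \<Rightarrow> (complex^'n) set
     \<Rightarrow> (complex^'n \<Rightarrow> complex^'n) \<Rightarrow> bool" where
  "tangent_field \<Omega> \<rho> U L \<longleftrightarrow>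
     boundary_nbhd \<Omega> \<rho> U \<and> smooth_on U L \<and> (\<forall>z\<in>U. vec10 (L z) (cpx \<rho>) z = 0)"

definition levi_null_set ::
  "(complex^'n::finite) set \<Rightarrow> (complex^'n \<Rightarrow> real) \<Rightarrow> (complex^'n \<Rightarrow> complex^'n)
     \<Rightarrow> (complex^'n) set" where
  "levi_null_set \<Omega> \<rho> L = {p\<in>frontier \<Omega>. levi \<rho> p (L p) (L p) = 0}"

text \<open>\<open>N\<close> is a complex vector field, so \<open>N \<L>\<^sub>\<rho>(L,L)\<close> is formally a complex number. On
  pseudoconvex domains it is real at the points of \<open>levi_null_set \<Omega> \<rho> L\<close>: there the function
  \<open>\<L>\<^sub>\<rho>(L,L)\<close> attains its minimum over the boundary, so its derivative along the tangential
  direction \<open>Im N\<close> vanishes. The real part below therefore discards nothing.\<close>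

definition eta_admissible ::
  "(complex^'n::finite) set \<Rightarrow> (complex^'n \<Rightarrow> real) \<Rightarrow> real \<Rightarrow> bool" where
  "eta_admissible \<Omega> \<rho> \<eta> \<longleftrightarrow>
     (\<forall>U L. tangent_field \<Omega> \<rho> U L \<longrightarrow>
        (\<forall>p\<in>levi_null_set \<Omega> \<rho> L.
           1 / (\<eta> - 1) * ((cmod (levi \<rho> p (L p) (normal10 \<rho> p)))\<^sup>2 / (norm (gradient \<rho> p))\<^sup>2)
           - 1 / 2 * (Re (vec10 (normal10 \<rho> p) (\<lambda>z. levi \<rho> z (L z) (L z)) p)
                      / norm (gradient \<rho> p)) \<le> 0))"

definition eta_exponent ::
  "(complex^'n::finite) set \<Rightarrow> (complex^'n \<Rightarrow> real) \<Rightarrow> ereal" where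
  "eta_exponent \<Omega> \<rho> = Inf (ereal ` {\<eta>. 1 < \<eta> \<and> eta_admissible \<Omega> \<rho> \<eta>})"

end

theory Submission
  imports Defs
begin

text \<open>A direct computation shows that \<open>\<rho>\<^sup>\<eta>\<close> is strictly plurisubharmonic at an exterior point iff
  \<open>\<L>\<^sub>\<rho>(a,a) + (\<eta> - 1) |a\<rho>|\<^sup>2 / \<rho> > 0\<close> for all \<open>a \<noteq> 0\<close>. Writing \<open>a = L + \<beta> N\<close> with \<open>L\<rho> = 0\<close> turns this
  into a quadratic polynomial in \<open>\<beta>\<close>, whose discriminant condition compares \<open>\<rho> |\<L>\<^sub>\<rho>(L,N)|\<^sup>2\<close> with
  \<open>\<L>\<^sub>\<rho>(L,L)\<close>. Dividing by the distance to a boundary point of \<open>\<Sigma>\<^sub>L\<close> and letting it tend to 0 along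
  the normal gives exactly the admissibility inequality, so \<open>\<eta>\<^sub>\<rho>\<close> is at most the exponent of \<open>\<rho>\<close>.

  Conversely, on a pseudoconvex domain \<open>\<L>\<^sub>\<rho>(L,L) \<ge> 0\<close> on the boundary, so admissibility and compactness
  of the boundary times the unit sphere bound the form above from below by \<open>- \<kappa> \<rho> |a|\<^sup>2\<close> for every
  \<open>\<kappa> > 0\<close>. Multiplying \<open>\<rho>\<close> by \<open>exp (\<delta> |z|\<^sup>2)\<close> with a small \<open>\<delta>\<close> absorbs this error at the price of an
  arbitrarily small increase of \<open>\<eta>\<close>.\<close>

section \<open>Calculus of smooth functions\<close>

text \<open>Admissibility says something only at null points of the Levi form on the boundary, and
  it is not strict, whereas the converse needs a bound at every nearby exterior point. An exterior
  point is therefore moved back to the boundary in one fixed direction, the normal at a limit point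
  \<open>p\<close>, rather than by nearest-point projection. Its foot point need not be a null
  point: pseudoconvexity gives the sign of the Levi form there, and the mean value theorem compares
  slopes. The vector \<open>a\<close> is a variable next to the point, so one compactness argument
  covers all directions, and in this half only projections of constant vectors serve as test fields.
  The missing strictness is paid for by \<open>\<kappa>\<close>; repairing it changes the defining
  function, so this half compares \<open>\<eta>_\<rho>\<close> with the index, while the other half
  compares the two exponents of each \<open>\<rho>\<close> separately. Second-order work is done
  with real Hessians in the directions \<open>a\<close> and \<open>\<i> *s a\<close>.\<close>

abbreviation dderiv :: "('a::real_normed_vector \<Rightarrow> 'b::real_normed_vector) \<Rightarrow> 'a \<Rightarrow> 'a \<Rightarrow> 'b" where
  "dderiv f v x \<equiv> frechet_derivative f (at x) v"

lemma frechet_derivative_eq: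
  "(f has_derivative f') (at x) \<Longrightarrow> frechet_derivative f (at x) = f'"
  using frechet_derivative_at by metis

lemma differentiable_has_frechet_derivative:
  "f differentiable (at x) \<Longrightarrow> (f has_derivative frechet_derivative f (at x)) (at x)"
  using frechet_derivative_works by blast

text \<open>\<open>frechet_derivative\<close> looks at a full neighbourhood, so on an open set it
  depends only on the values inside that set. The closure rules below compute a derivative by a
  formula valid on \<open>S\<close> alone and transfer regularity through this congruence.\<close>

lemma Ck_on_cong:
  assumes "open S" "\<And>x. x \<in> S \<Longrightarrow> f x = g x" "Ck_on k S f"
  shows "Ck_on k S g"
  using assms(2,3)
proof (induction k arbitrary: f g)
  case 0
  then show ?case by (auto cong: continuous_on_cong)
next
  case (Suc k)
  have d: "(g has_derivative frechet_derivative f (at x)) (at x)" if "x \<in> S" for x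
    using Suc.prems that assms(1)
    by (auto intro: has_derivative_transform_within_open[OF differentiable_has_frechet_derivative])
  have "Ck_on k S (\<lambda>x. frechet_derivative g (at x) v)" for v
  proof (rule Suc.IH)
    show "Ck_on k S (\<lambda>x. frechet_derivative f (at x) v)" using Suc.prems(2) by simp
  qed (simp add: frechet_derivative_eq[OF d])
  then show ?case using d by (auto simp: differentiable_def)
qed

lemma Ck_on_SucI:
  assumes "open S" "\<And>x. x \<in> S \<Longrightarrow> (f has_derivative f' x) (at x)" "\<And>v. Ck_on k S (\<lambda>x. f' x v)"
  shows "Ck_on (Suc k) S f"
proof -
  have "Ck_on k S (\<lambda>x. frechet_derivative f (at x) v)" for v
    by (rule Ck_on_cong[OF assms(1) _ assms(3)]) (simp add: frechet_derivative_eq[OF assms(2)])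
  then show ?thesis using assms(2) by (auto simp: differentiable_def)
qed

lemma Ck_on_Suc_has_derivative:
  "Ck_on (Suc k) S f \<Longrightarrow> x \<in> S \<Longrightarrow> (f has_derivative frechet_derivative f (at x)) (at x)"
  using differentiable_has_frechet_derivative by auto

lemma Ck_on_Suc_imp_Ck_on: "Ck_on (Suc k) S f \<Longrightarrow> Ck_on k S f"
proof (induction k arbitrary: f)
  case 0
  then show ?case
    by (auto intro!: continuous_at_imp_continuous_on differentiable_imp_continuous_within)
next
  case (Suc k)
  then show ?case by (metis Ck_on.simps(2))
qed

lemma Ck_on_subset: "Ck_on k S f \<Longrightarrow> T \<subseteq> S \<Longrightarrow> Ck_on k T f"
  by (induction k arbitrary: f) (auto intro: continuous_on_subset)

lemma Ck_on_const: "Ck_on k S (\<lambda>x. c)"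
  by (induction k arbitrary: c) auto

lemma Ck_on_add:
  assumes "open S" "Ck_on k S f" "Ck_on k S g"
  shows "Ck_on k S (\<lambda>x. f x + g x)"
  using assms(2,3)
proof (induction k arbitrary: f g)
  case 0
  then show ?case by (auto intro: continuous_intros)
next
  case (Suc k)
  show ?case
    by (rule Ck_on_SucI[OF assms(1) has_derivative_add
          [OF Ck_on_Suc_has_derivative[OF Suc.prems(1)] Ck_on_Suc_has_derivative[OF Suc.prems(2)]]])
      (use Suc in auto)
qed

lemma Ck_on_linear:
  assumes "open S" "bounded_linear h" "Ck_on k S f"
  shows "Ck_on k S (\<lambda>x. h (f x))"
  using assms(3)
proof (induction k arbitrary: f)
  case 0
  then show ?case using assms(2) by (auto intro: bounded_linear.continuous_on)
next
  case (Suc k)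
  show ?case
    by (rule Ck_on_SucI[OF assms(1) bounded_linear.has_derivative
          [OF assms(2) Ck_on_Suc_has_derivative[OF Suc.prems(1)]]])
      (use Suc in auto)
qed

lemma Ck_on_bilinear:
  assumes "open S" "bounded_bilinear h" "Ck_on k S f" "Ck_on k S g"
  shows "Ck_on k S (\<lambda>x. h (f x) (g x))"
  using assms(3,4)
proof (induction k arbitrary: f g)
  case 0
  then show ?case using bounded_bilinear.continuous_on[OF assms(2)] by auto
next
  case (Suc k)
  show ?case
  proof (rule Ck_on_SucI[OF assms(1) bounded_bilinear.FDERIV
          [OF assms(2) Ck_on_Suc_has_derivative[OF Suc.prems(1)] Ck_on_Suc_has_derivative[OF Suc.prems(2)]]])
    show "Ck_on k S (\<lambda>x. h (f x) (frechet_derivative g (at x) v) + h (frechet_derivative f (at x) v) (g x))" for v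
      using Suc.prems Suc.prems[THEN Ck_on_Suc_imp_Ck_on]
      by (auto intro!: Ck_on_add[OF assms(1)] Suc.IH)
  qed auto
qed

lemma Ck_on_affine:
  fixes h :: "'a::euclidean_space \<Rightarrow> 'b::euclidean_space"
  assumes "open S" "bounded_linear h" "Ck_on k T f" "\<And>x. x \<in> S \<Longrightarrow> c + h x \<in> T"
  shows "Ck_on k S (\<lambda>x. f (c + h x))"
  using assms(3)
proof (induction k arbitrary: f)
  case 0
  have "continuous_on S (\<lambda>x. c + h x)"
    using assms(2) by (intro continuous_intros linear_continuous_on)
  moreover have "continuous_on T f" using 0 by simp
  ultimately have "continuous_on S (\<lambda>x. f (c + h x))"
    using continuous_on_compose2[of T f S "\<lambda>x. c + h x"] assms(4) by auto
  then show ?case by simp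
next
  case (Suc k)
  have "((\<lambda>x. f (c + h x)) has_derivative (\<lambda>v. frechet_derivative f (at (c + h x)) (h v))) (at x)"
    if "x \<in> S" for x
  proof -
    have "((\<lambda>x. c + h x) has_derivative h) (at x)"
      using bounded_linear_imp_has_derivative[OF assms(2), of "at x"] by (auto intro!: derivative_eq_intros)
    from has_derivative_compose[OF this Ck_on_Suc_has_derivative[OF Suc.prems assms(4)[OF that]]]
    show ?thesis .
  qed
  then show ?case
    by (rule Ck_on_SucI[OF assms(1)]) (use Suc in auto)
qed

text \<open>Differentiating \<open>g n (f x)\<close> produces \<open>g (Suc n) (f x)\<close>, so the
  outer function is given as a whole chain of derivatives and \<open>n\<close> stays general in the
  induction.\<close>

lemma Ck_on_compose_real:
  fixes f :: "'a::euclidean_space \<Rightarrow> real" and g :: "nat \<Rightarrow> real \<Rightarrow> real"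
  assumes "open S" "\<And>n t. t \<in> T \<Longrightarrow> (g n has_real_derivative g (Suc n) t) (at t)"
    "Ck_on k S f" "\<And>x. x \<in> S \<Longrightarrow> f x \<in> T"
  shows "Ck_on k S (\<lambda>x. g n (f x))"
  using assms(3)
proof (induction k arbitrary: n)
  case 0
  have "continuous_on T (g n)"
    using DERIV_isCont[OF assms(2)] by (simp add: continuous_at_imp_continuous_on)
  then have "continuous_on S (\<lambda>x. g n (f x))"
    using continuous_on_compose2[of T "g n" S f] assms(4) 0 by auto
  then show ?case by simp
next
  case (Suc k)
  have "((\<lambda>x. g n (f x)) has_derivative (\<lambda>v. g (Suc n) (f x) * frechet_derivative f (at x) v)) (at x)"
    if "x \<in> S" for x
    using has_derivative_compose[OF Ck_on_Suc_has_derivative[OF Suc.prems that]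
        assms(2)[OF assms(4)[OF that], of n, unfolded has_field_derivative_def]] .
  moreover have "Ck_on k S (\<lambda>x. g (Suc n) (f x) * frechet_derivative f (at x) v)" for v
    using Suc.prems
    by (intro Ck_on_bilinear[OF assms(1) bounded_bilinear_mult] Suc.IH Ck_on_Suc_imp_Ck_on[OF Suc.prems]) simp
  ultimately show ?case
    by (rule Ck_on_SucI[OF assms(1)])
qed

lemma smooth_on_imp_Ck_on: "smooth_on S f \<Longrightarrow> Ck_on k S f"
  by (simp add: smooth_on_def)

lemma smooth_on_cong:
  "open S \<Longrightarrow> (\<And>x. x \<in> S \<Longrightarrow> f x = g x) \<Longrightarrow> smooth_on S f \<Longrightarrow> smooth_on S g"
  unfolding smooth_on_def using Ck_on_cong by blast

lemma smooth_on_subset: "smooth_on S f \<Longrightarrow> T \<subseteq> S \<Longrightarrow> smooth_on T f"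
  unfolding smooth_on_def using Ck_on_subset by blast

lemma smooth_on_dderiv: "smooth_on S f \<Longrightarrow> smooth_on S (dderiv f v)"
  unfolding smooth_on_def by (metis Ck_on.simps(2))

lemma smooth_on_has_derivative:
  "smooth_on S f \<Longrightarrow> x \<in> S \<Longrightarrow> (f has_derivative frechet_derivative f (at x)) (at x)"
  using Ck_on_Suc_has_derivative smooth_on_def by blast

lemma smooth_on_differentiable: "smooth_on S f \<Longrightarrow> x \<in> S \<Longrightarrow> f differentiable (at x)"
  using smooth_on_has_derivative differentiable_def by blast

lemma smooth_on_isCont: "smooth_on S f \<Longrightarrow> x \<in> S \<Longrightarrow> isCont f x"
  using smooth_on_has_derivative has_derivative_continuous by blast

lemma smooth_on_const: "smooth_on S (\<lambda>x. c)"
  by (simp add: smooth_on_def Ck_on_const)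

lemma smooth_on_add:
  "open S \<Longrightarrow> smooth_on S f \<Longrightarrow> smooth_on S g \<Longrightarrow> smooth_on S (\<lambda>x. f x + g x)"
  by (simp add: smooth_on_def Ck_on_add)

lemma smooth_on_sum:
  assumes "open S" "\<And>i. i \<in> I \<Longrightarrow> smooth_on S (f i)"
  shows "smooth_on S (\<lambda>x. \<Sum>i\<in>I. f i x)"
  using assms(2)
  by (induction I rule: infinite_finite_induct) (auto intro: smooth_on_const smooth_on_add[OF assms(1)])

lemma smooth_on_linear:
  "open S \<Longrightarrow> bounded_linear h \<Longrightarrow> smooth_on S f \<Longrightarrow> smooth_on S (\<lambda>x. h (f x))"
  by (simp add: smooth_on_def Ck_on_linear)

lemma smooth_on_bilinear:
  "open S \<Longrightarrow> bounded_bilinear h \<Longrightarrow> smooth_on S f \<Longrightarrow> smooth_on S g \<Longrightarrow>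
    smooth_on S (\<lambda>x. h (f x) (g x))"
  by (simp add: smooth_on_def Ck_on_bilinear)

lemma smooth_on_affine:
  "open S \<Longrightarrow> bounded_linear h \<Longrightarrow> smooth_on T f \<Longrightarrow> (\<And>x. x \<in> S \<Longrightarrow> c + h x \<in> T) \<Longrightarrow>
    smooth_on S (\<lambda>x. f (c + h x))"
  unfolding smooth_on_def using Ck_on_affine by blast

lemma smooth_on_bounded_linear: "open S \<Longrightarrow> bounded_linear h \<Longrightarrow> smooth_on S h"
  unfolding smooth_on_def
proof
  fix k assume S: "open S" and h: "bounded_linear h"
  show "Ck_on k S h"
  proof (cases k)
    case 0
    then show ?thesis using h by (simp add: linear_continuous_on)
  next
    case (Suc m)
    then show ?thesis
      using Ck_on_SucI[OF S bounded_linear_imp_has_derivative[OF h] Ck_on_const] by simp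
  qed
qed

lemma smooth_on_diff:
  fixes f g :: "'a::euclidean_space \<Rightarrow> 'b::real_normed_vector"
  assumes "open S" "smooth_on S f" "smooth_on S g"
  shows "smooth_on S (\<lambda>x. f x - g x)"
  using smooth_on_add[OF assms(1,2) smooth_on_linear[OF assms(1) bounded_linear_minus[OF bounded_linear_ident] assms(3)]]
  by simp

lemma smooth_on_mult:
  fixes f g :: "'a::euclidean_space \<Rightarrow> 'b::real_normed_algebra"
  shows "open S \<Longrightarrow> smooth_on S f \<Longrightarrow> smooth_on S g \<Longrightarrow> smooth_on S (\<lambda>x. f x * g x)"
  by (rule smooth_on_bilinear[OF _ bounded_bilinear_mult])

lemma smooth_on_exp:
  fixes f :: "'a::euclidean_space \<Rightarrow> real"
  assumes "open S" "smooth_on S f"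
  shows "smooth_on S (\<lambda>x. exp (f x))"
  using Ck_on_compose_real[of S UNIV "\<lambda>_. exp"] assms by (auto simp: smooth_on_def)

text \<open>The derivative chain of a real power, in the shape \<open>Ck_on_compose_real\<close>
  expects; the product is the falling factorial \<open>r (r - 1) ... (r - n + 1)\<close>.\<close>

lemma DERIV_iterate_powr:
  fixes r :: real
  assumes "0 < t"
  shows "((\<lambda>t. (\<Prod>i<n. r - real i) * t powr (r - real n)) has_real_derivative
           (\<Prod>i<Suc n. r - real i) * t powr (r - real (Suc n))) (at t)"
  using assms by (auto intro!: derivative_eq_intros simp: algebra_simps)

lemma smooth_on_powr:
  fixes f :: "'a::euclidean_space \<Rightarrow> real"
  assumes "open S" "smooth_on S f" "\<And>x. x \<in> S \<Longrightarrow> 0 < f x"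
  shows "smooth_on S (\<lambda>x. f x powr r)"
  using Ck_on_compose_real[of S "{0<..}" "\<lambda>n t. (\<Prod>i<n. r - real i) * t powr (r - real n)" _ f 0]
    assms DERIV_iterate_powr[of _ r] by (auto simp: smooth_on_def)

lemma sum_axis: "(\<Sum>j\<in>UNIV. axis j (v $ j)) = (v :: 'a::comm_monoid_add^'n::finite)"
  by (simp add: vec_eq_iff axis_def)

lemma smooth_on_vec:
  fixes f :: "'a::euclidean_space \<Rightarrow> complex^'n::finite"
  assumes "open S" "\<And>j. smooth_on S (\<lambda>x. f x $ j)"
  shows "smooth_on S f"
proof -
  have "bounded_linear (axis j :: complex \<Rightarrow> complex^'n)" for j
    by (intro linear_conv_bounded_linear[THEN iffD1] linearI) (auto simp: vec_eq_iff axis_def)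
  then have "smooth_on S (\<lambda>x. \<Sum>j\<in>UNIV. axis j (f x $ j))"
    by (rule smooth_on_sum[OF assms(1) smooth_on_linear[OF assms(1) _ assms(2)]])
  then show ?thesis by (simp add: sum_axis)
qed

section \<open>Second derivatives\<close>

lemma Ck_on_2_differentiable:
  assumes "Ck_on 2 S f" "x \<in> S"
  shows "f differentiable (at x)" "dderiv f v differentiable (at x)"
  using assms by (auto simp: numeral_2_eq_2)

lemma Ck_on_2_isCont_hessian:
  assumes "open S" "Ck_on 2 S f" "x \<in> S"
  shows "isCont (dderiv (dderiv f v) u) x"
  using assms by (auto simp: numeral_2_eq_2 continuous_on_eq_continuous_at)

lemma dderiv_linear:
  assumes "f differentiable (at x)"
  shows "dderiv f (u + v) x = dderiv f u x + dderiv f v x"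
    "dderiv f (c *\<^sub>R v) x = c *\<^sub>R dderiv f v x"
    "dderiv f (- v) x = - dderiv f v x" "dderiv f 0 x = 0"
  using linear_frechet_derivative[OF assms]
  by (simp_all add: linear_add linear_scale linear_neg linear_0)

lemma has_real_derivative_along_line:
  fixes f :: "'a::real_normed_vector \<Rightarrow> real"
  assumes "f differentiable (at (x + t *\<^sub>R v))"
  shows "((\<lambda>t. f (x + t *\<^sub>R v)) has_real_derivative dderiv f v (x + t *\<^sub>R v)) (at t)"
proof -
  have "((\<lambda>t. x + t *\<^sub>R v) has_derivative (\<lambda>h. h *\<^sub>R v)) (at t)"
    by (auto intro!: derivative_eq_intros)
  from has_derivative_compose[OF this differentiable_has_frechet_derivative[OF assms]]
  show ?thesis
    by (simp add: has_field_derivative_def dderiv_linear(2)[OF assms] mult.commute[of _ "dderiv f v _"])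
qed

text \<open>Mean value theorem twice, first along \<open>u\<close>, then along \<open>v\<close>. The
  second difference is symmetric in \<open>u\<close> and \<open>v\<close> while the order of
  differentiation is not; swapping the roles yields the symmetry of the Hessian.\<close>

lemma second_difference_mvt:
  fixes f :: "'a::euclidean_space \<Rightarrow> real"
  assumes C: "Ck_on 2 S f" and h: "0 < h"
    and seg: "\<And>s t. 0 \<le> s \<Longrightarrow> s \<le> h \<Longrightarrow> 0 \<le> t \<Longrightarrow> t \<le> h \<Longrightarrow> x + s *\<^sub>R u + t *\<^sub>R v \<in> S"
  shows "\<exists>s t. 0 < s \<and> s < h \<and> 0 < t \<and> t < h \<and>
    f (x + h *\<^sub>R u + h *\<^sub>R v) - f (x + h *\<^sub>R u) - f (x + h *\<^sub>R v) + f x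
      = h * (h * dderiv (dderiv f u) v (x + s *\<^sub>R u + t *\<^sub>R v))"
proof -
  define \<phi> where "\<phi> = (\<lambda>s. f ((x + h *\<^sub>R v) + s *\<^sub>R u) - f (x + s *\<^sub>R u))"
  have d: "f differentiable (at (x + h *\<^sub>R v + s *\<^sub>R u))" "f differentiable (at (x + s *\<^sub>R u))"
    if "0 \<le> s" "s \<le> h" for s
    using Ck_on_2_differentiable(1)[OF C seg[OF that, of h]] Ck_on_2_differentiable(1)[OF C seg[OF that, of 0]] h
    by (simp_all add: algebra_simps)
  have "\<exists>s>0. s < h \<and> \<phi> h - \<phi> 0 = (h - 0) * (dderiv f u ((x + h *\<^sub>R v) + s *\<^sub>R u) - dderiv f u (x + s *\<^sub>R u))"
    unfolding \<phi>_def
    by (intro MVT2 h DERIV_diff has_real_derivative_along_line d)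
  then obtain s where s: "0 < s" "s < h"
    "\<phi> h - \<phi> 0 = h * (dderiv f u ((x + h *\<^sub>R v) + s *\<^sub>R u) - dderiv f u (x + s *\<^sub>R u))" by auto
  have d2: "dderiv f u differentiable (at (x + s *\<^sub>R u + t *\<^sub>R v))" if "0 \<le> t" "t \<le> h" for t
    using Ck_on_2_differentiable(2)[OF C] seg s that by auto
  have "\<exists>t>0. t < h \<and> dderiv f u (x + s *\<^sub>R u + h *\<^sub>R v) - dderiv f u (x + s *\<^sub>R u + 0 *\<^sub>R v)
      = (h - 0) * dderiv (dderiv f u) v (x + s *\<^sub>R u + t *\<^sub>R v)"
    by (intro MVT2 h has_real_derivative_along_line d2)
  then obtain t where "0 < t" "t < h" "dderiv f u (x + s *\<^sub>R u + h *\<^sub>R v) - dderiv f u (x + s *\<^sub>R u)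
      = h * dderiv (dderiv f u) v (x + s *\<^sub>R u + t *\<^sub>R v)" by auto
  with s show ?thesis
    by (intro exI[of _ s] exI[of _ t]) (simp add: \<phi>_def algebra_simps)
qed

lemma isCont_tendsto_nhds: "isCont g x \<Longrightarrow> (g \<longlongrightarrow> g x) (nhds x)"
  by (simp add: isCont_def tendsto_at_iff_tendsto_nhds)

lemma hessian_symmetric:
  fixes f :: "'a::euclidean_space \<Rightarrow> real"
  assumes S: "open S" "Ck_on 2 S f" "x \<in> S"
  shows "dderiv (dderiv f u) v x = dderiv (dderiv f v) u x"
proof (rule ccontr)
  assume ne: "\<not> ?thesis"
  define e where "e = \<bar>dderiv (dderiv f u) v x - dderiv (dderiv f v) u x\<bar> / 2"
  have e: "0 < e" using ne by (simp add: e_def)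
  have "\<forall>\<^sub>F y in nhds x. dist (dderiv (dderiv f u) v y) (dderiv (dderiv f u) v x) < e"
    "\<forall>\<^sub>F y in nhds x. dist (dderiv (dderiv f v) u y) (dderiv (dderiv f v) u x) < e"
    using e by (auto intro!: tendstoD[OF isCont_tendsto_nhds] Ck_on_2_isCont_hessian[OF S])
  moreover have "\<forall>\<^sub>F y in nhds x. y \<in> S" using S by (simp add: eventually_nhds_in_open)
  ultimately have "\<forall>\<^sub>F y in nhds x. y \<in> S \<and> dist (dderiv (dderiv f u) v y) (dderiv (dderiv f u) v x) < e
     \<and> dist (dderiv (dderiv f v) u y) (dderiv (dderiv f v) u x) < e"
    by eventually_elim auto
  then obtain d where d: "0 < d" and D: "\<And>y. dist y x < d \<Longrightarrow> y \<in> S \<and>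
     dist (dderiv (dderiv f u) v y) (dderiv (dderiv f u) v x) < e
     \<and> dist (dderiv (dderiv f v) u y) (dderiv (dderiv f v) u x) < e"
    unfolding eventually_nhds_metric by blast
  \<comment> \<open>With this step length the parallelogram spanned by \<open>h *\<^sub>R u\<close>
    and \<open>h *\<^sub>R v\<close> stays in the ball of radius \<open>d\<close>; the summand 1
    covers the case that both vectors vanish.\<close>
  define h where "h = d / (norm u + norm v + 1)"
  have h: "0 < h" using d by (simp add: h_def add_nonneg_pos)
  have near: "dist (x + s *\<^sub>R u + t *\<^sub>R v) x < d"
    if "0 \<le> s" "s \<le> h" "0 \<le> t" "t \<le> h" for s t
  proof -
    have "dist (x + s *\<^sub>R u + t *\<^sub>R v) x \<le> s * norm u + t * norm v"
      using norm_triangle_ineq[of "s *\<^sub>R u" "t *\<^sub>R v"] that by (simp add: dist_norm)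
    also have "\<dots> \<le> h * norm u + h * norm v"
      using that by (intro add_mono mult_right_mono) auto
    also have "\<dots> < h * (norm u + norm v + 1)" using h by (simp add: algebra_simps)
    also have "\<dots> = d" using add_nonneg_pos[of "norm u + norm v" 1] by (simp add: h_def)
    finally show ?thesis .
  qed
  obtain s t where 1: "0 < s" "s < h" "0 < t" "t < h"
    "f (x + h *\<^sub>R u + h *\<^sub>R v) - f (x + h *\<^sub>R u) - f (x + h *\<^sub>R v) + f x
      = h * (h * dderiv (dderiv f u) v (x + s *\<^sub>R u + t *\<^sub>R v))"
    using second_difference_mvt[OF S(2) h, of x u v] near D by blast
  have near': "x + t *\<^sub>R v + s *\<^sub>R u \<in> S" if "0 \<le> s" "s \<le> h" "0 \<le> t" "t \<le> h" for s t
    using D[OF near[OF that]] by (simp add: algebra_simps)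
  obtain s' t' where 2: "0 < s'" "s' < h" "0 < t'" "t' < h"
    "f (x + h *\<^sub>R v + h *\<^sub>R u) - f (x + h *\<^sub>R v) - f (x + h *\<^sub>R u) + f x
      = h * (h * dderiv (dderiv f v) u (x + s' *\<^sub>R v + t' *\<^sub>R u))"
    using second_difference_mvt[OF S(2) h, of x v u] near' by blast
  have "h * (h * dderiv (dderiv f u) v (x + s *\<^sub>R u + t *\<^sub>R v))
      = h * (h * dderiv (dderiv f v) u (x + t' *\<^sub>R u + s' *\<^sub>R v))"
    using 1(5) 2(5) by (simp add: algebra_simps)
  then have "dderiv (dderiv f u) v (x + s *\<^sub>R u + t *\<^sub>R v)
      = dderiv (dderiv f v) u (x + t' *\<^sub>R u + s' *\<^sub>R v)" using h by simp
  moreover have "dist (dderiv (dderiv f u) v (x + s *\<^sub>R u + t *\<^sub>R v)) (dderiv (dderiv f u) v x) < e"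
    using D[OF near, of s t] 1 by simp
  moreover have "dist (dderiv (dderiv f v) u (x + t' *\<^sub>R u + s' *\<^sub>R v)) (dderiv (dderiv f v) u x) < e"
    using D[OF near, of t' s'] 2 by simp
  moreover have "\<bar>dderiv (dderiv f u) v x - dderiv (dderiv f v) u x\<bar> = 2 * e" by (simp add: e_def)
  ultimately show False unfolding dist_real_def by arith
qed


lemma hessian_compose_real:
  fixes f :: "'a::euclidean_space \<Rightarrow> real"
  assumes S: "open S" "Ck_on 2 S f" "x \<in> S" and T: "\<And>y. y \<in> S \<Longrightarrow> f y \<in> T"
    and g: "\<And>t. t \<in> T \<Longrightarrow> (g has_real_derivative g' t) (at t)"
    and g': "\<And>t. t \<in> T \<Longrightarrow> (g' has_real_derivative g'' t) (at t)"
  shows "dderiv (dderiv (\<lambda>y. g (f y)) v) v x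
    = g' (f x) * dderiv (dderiv f v) v x + g'' (f x) * (dderiv f v x)\<^sup>2"
proof -
  note d = Ck_on_2_differentiable[OF S(2), THEN differentiable_has_frechet_derivative]
  have 1: "dderiv (\<lambda>y. g (f y)) v y = g' (f y) * dderiv f v y" if "y \<in> S" for y
    using frechet_derivative_eq[OF has_derivative_compose[OF d(1)[OF that]
      g[OF T[OF that], unfolded has_field_derivative_def]]] by simp
  have "((\<lambda>y. g' (f y) * dderiv f v y) has_derivative
      (\<lambda>w. g' (f x) * dderiv (dderiv f v) w x + g'' (f x) * dderiv f w x * dderiv f v x)) (at x)"
    by (rule has_derivative_mult[OF has_derivative_compose[OF d(1)[OF S(3)]
      g'[OF T[OF S(3)], unfolded has_field_derivative_def]] d(2)[OF S(3)]])
  then have "(dderiv (\<lambda>y. g (f y)) v has_derivative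
      (\<lambda>w. g' (f x) * dderiv (dderiv f v) w x + g'' (f x) * dderiv f w x * dderiv f v x)) (at x)"
    by (rule has_derivative_transform_within_open[OF _ S(1,3)]) (simp add: 1)
  then show ?thesis by (simp add: frechet_derivative_eq power2_eq_square algebra_simps)
qed

section \<open>The Levi form and the complex gradient\<close>

lemma has_derivative_cpx:
  assumes "\<rho> differentiable (at z)"
  shows "(cpx \<rho> has_derivative (\<lambda>v. complex_of_real (dderiv \<rho> v z))) (at z)"
  using bounded_linear.has_derivative[OF bounded_linear_of_real differentiable_has_frechet_derivative[OF assms]] .

text \<open>A real differentiable function has a real-linear derivative, so a (1,0) vector acts
  through the two real directions \<open>a\<close> and \<open>\<i> *s a\<close>. This frees later
  computations from coordinates.\<close>

lemma vec10_eq: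
  fixes f :: "complex^'n::finite \<Rightarrow> complex"
  assumes "f differentiable (at z)"
  shows "vec10 a f z = (dderiv f a z - \<i> * dderiv f (\<i> *s a) z) / 2"
proof -
  have lin: "linear (\<lambda>v. dderiv f v z)"
    using linear_frechet_derivative[OF assms] by simp
  have "Re (a $ j) *\<^sub>R axis j 1 + Im (a $ j) *\<^sub>R axis j \<i> = axis j (a $ j)" for j
    by (simp add: vec_eq_iff axis_def complex_eq_iff)
  then have "a = (\<Sum>j\<in>UNIV. Re (a $ j) *\<^sub>R axis j 1 + Im (a $ j) *\<^sub>R axis j \<i>)"
    by (simp add: sum_axis)
  then have 1: "dderiv f a z = (\<Sum>j\<in>UNIV. Re (a $ j) *\<^sub>R dderiv f (axis j 1) z + Im (a $ j) *\<^sub>R dderiv f (axis j \<i>) z)"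
    using linear_sum[OF lin, of "\<lambda>j. Re (a $ j) *\<^sub>R axis j 1 + Im (a $ j) *\<^sub>R axis j \<i>" UNIV]
    by (simp add: linear_add[OF lin] linear_scale[OF lin])
  have "Re (a $ j) *\<^sub>R axis j \<i> + (- Im (a $ j)) *\<^sub>R axis j 1 = axis j ((\<i> *s a) $ j)" for j
    by (simp add: vec_eq_iff axis_def complex_eq_iff)
  then have "\<i> *s a = (\<Sum>j\<in>UNIV. Re (a $ j) *\<^sub>R axis j \<i> + (- Im (a $ j)) *\<^sub>R axis j 1)"
    by (simp only: sum_axis)
  then have 2: "dderiv f (\<i> *s a) z = (\<Sum>j\<in>UNIV. Re (a $ j) *\<^sub>R dderiv f (axis j \<i>) z + (- Im (a $ j)) *\<^sub>R dderiv f (axis j 1) z)"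
    using linear_sum[OF lin, of "\<lambda>j. Re (a $ j) *\<^sub>R axis j \<i> + (- Im (a $ j)) *\<^sub>R axis j 1" UNIV]
    unfolding linear_add[OF lin] linear_scale[OF lin] by simp
  have "dderiv f a z - \<i> * dderiv f (\<i> *s a) z
      = (\<Sum>j\<in>UNIV. a $ j * (dderiv f (axis j 1) z - \<i> * dderiv f (axis j \<i>) z))"
    unfolding 1 2 sum_distrib_left sum_subtractf[symmetric]
    by (rule sum.cong) (simp_all add: complex_eq_iff algebra_simps)
  then show ?thesis
    by (simp add: vec10_def dz_def sum_divide_distrib)
qed

lemma vec10_cpx:
  fixes \<rho> :: "complex^'n::finite \<Rightarrow> real"
  assumes "\<rho> differentiable (at z)"
  shows "vec10 a (cpx \<rho>) z = Complex (dderiv \<rho> a z / 2) (- dderiv \<rho> (\<i> *s a) z / 2)"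
  using has_derivative_cpx[OF assms]
  by (subst vec10_eq) (auto simp: differentiable_def frechet_derivative_eq complex_eq_iff)

lemma cmod_vec10_cpx:
  fixes \<rho> :: "complex^'n::finite \<Rightarrow> real"
  assumes "\<rho> differentiable (at z)"
  shows "(cmod (vec10 a (cpx \<rho>) z))\<^sup>2 = ((dderiv \<rho> a z)\<^sup>2 + (dderiv \<rho> (\<i> *s a) z)\<^sup>2) / 4"
  by (simp add: vec10_cpx[OF assms] cmod_power2 power_divide)

lemma dzbar_cpx:
  fixes \<rho> :: "complex^'n::finite \<Rightarrow> real"
  assumes "\<rho> differentiable (at z)"
  shows "dzbar j (cpx \<rho>) z = (of_real (dderiv \<rho> (axis j 1) z) + \<i> * of_real (dderiv \<rho> (axis j \<i>) z)) / 2"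
  by (simp add: dzbar_def frechet_derivative_eq[OF has_derivative_cpx[OF assms]])

lemma dz_cpx:
  fixes \<rho> :: "complex^'n::finite \<Rightarrow> real"
  assumes "\<rho> differentiable (at z)"
  shows "dz j (cpx \<rho>) z = cnj (dzbar j (cpx \<rho>) z)"
  by (simp add: dzbar_def dz_def frechet_derivative_eq[OF has_derivative_cpx[OF assms]])

lemma has_derivative_dzbar_cpx:
  fixes \<rho> :: "complex^'n::finite \<Rightarrow> real"
  assumes S: "open S" "Ck_on 2 S \<rho>" "z \<in> S"
  shows "(dzbar j (cpx \<rho>) has_derivative (\<lambda>u. (of_real (dderiv (dderiv \<rho> (axis j 1)) u z)
     + \<i> * of_real (dderiv (dderiv \<rho> (axis j \<i>)) u z)) / 2)) (at z)"
proof -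
  note d = Ck_on_2_differentiable[OF S(2)]
  have "((\<lambda>z. (of_real (dderiv \<rho> (axis j 1) z) + \<i> * of_real (dderiv \<rho> (axis j \<i>) z)) / 2)
     has_derivative (\<lambda>u. (of_real (dderiv (dderiv \<rho> (axis j 1)) u z)
     + \<i> * of_real (dderiv (dderiv \<rho> (axis j \<i>)) u z)) / 2)) (at z)"
    by (rule has_derivative_divide' has_derivative_add has_derivative_mult_right has_derivative_cpx d S
      bounded_linear.has_derivative[OF bounded_linear_divide])+
  then show ?thesis
    by (rule has_derivative_transform_within_open[OF _ S(1,3)]) (simp add: dzbar_cpx d)
qed

text \<open>The coefficients of \<open>b\<close> are constant and \<open>\<rho>\<close> is real, so
  the conjugate of \<open>b \<rho>\<close> is the action of the conjugate field; applying
  \<open>a\<close> to it leaves exactly the mixed second derivatives.\<close>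

lemma levi_eq_vec10:
  fixes \<rho> :: "complex^'n::finite \<Rightarrow> real"
  assumes S: "open S" "Ck_on 2 S \<rho>" "z \<in> S"
  shows "levi \<rho> z a b = vec10 a (\<lambda>w. cnj (vec10 b (cpx \<rho>) w)) z"
proof -
  let ?F = "\<lambda>w. \<Sum>k\<in>UNIV. cnj (b $ k) * dzbar k (cpx \<rho>) w"
  note d = Ck_on_2_differentiable[OF S(2)]
  have h: "(dzbar k (cpx \<rho>) has_derivative frechet_derivative (dzbar k (cpx \<rho>)) (at z)) (at z)" for k
    using has_derivative_dzbar_cpx[OF S] by (intro differentiable_has_frechet_derivative) (auto simp: differentiable_def)
  have F: "((\<lambda>w. cnj (vec10 b (cpx \<rho>) w)) has_derivative (\<lambda>u. \<Sum>k\<in>UNIV. cnj (b $ k) * frechet_derivative (dzbar k (cpx \<rho>)) (at z) u)) (at z)"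
    by (rule has_derivative_transform_within_open
        [OF has_derivative_sum[OF has_derivative_mult_right[OF h, of "cnj (b $ _)"]] S(1,3)])
      (simp add: vec10_def dz_cpx d)
  have "a $ j * dz j (\<lambda>w. cnj (vec10 b (cpx \<rho>) w)) z = (\<Sum>k\<in>UNIV. dz j (dzbar k (cpx \<rho>)) z * a $ j * cnj (b $ k))" for j
    by (simp add: dz_def frechet_derivative_eq[OF F] sum_distrib_left sum_divide_distrib
        sum_subtractf[symmetric] algebra_simps)
  then show ?thesis by (simp add: levi_def vec10_def[of a])
qed

text \<open>On the diagonal this is a quarter of the sum of the real Hessians in the directions
  \<open>a\<close> and \<open>\<i> *s a\<close>. Inequalities between Levi forms thus reduce to
  inequalities between real Hessians along lines.\<close>

lemma levi_eq:
  fixes \<rho> :: "complex^'n::finite \<Rightarrow> real"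
  assumes S: "open S" "Ck_on 2 S \<rho>" "z \<in> S"
  shows "levi \<rho> z a b = Complex
    ((dderiv (dderiv \<rho> b) a z + dderiv (dderiv \<rho> (\<i> *s b)) (\<i> *s a) z) / 4)
    ((dderiv (dderiv \<rho> (\<i> *s b)) a z - dderiv (dderiv \<rho> b) (\<i> *s a) z) / 4)"
proof -
  note d = Ck_on_2_differentiable[OF S(2)]
  let ?F' = "\<lambda>u. (of_real (dderiv (dderiv \<rho> b) u z) + \<i> * of_real (dderiv (dderiv \<rho> (\<i> *s b)) u z)) / 2"
  have "((\<lambda>w. (of_real (dderiv \<rho> b w) + \<i> * of_real (dderiv \<rho> (\<i> *s b) w)) / 2) has_derivative ?F') (at z)"
    by (rule has_derivative_add has_derivative_mult_right has_derivative_cpx d S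
      bounded_linear.has_derivative[OF bounded_linear_divide])+
  then have F: "((\<lambda>w. cnj (vec10 b (cpx \<rho>) w)) has_derivative ?F') (at z)"
    by (rule has_derivative_transform_within_open[OF _ S(1,3)]) (simp add: vec10_cpx d complex_eq_iff)
  show ?thesis
    unfolding levi_eq_vec10[OF S]
    by (subst vec10_eq) (use F in \<open>auto simp: differentiable_def frechet_derivative_eq complex_eq_iff\<close>)
qed

lemma levi_add:
  "levi \<rho> z (a + a') b = levi \<rho> z a b + levi \<rho> z a' b"
  "levi \<rho> z a (b + b') = levi \<rho> z a b + levi \<rho> z a b'"
  by (simp_all add: levi_def algebra_simps sum.distrib)

lemma levi_scale:
  "levi \<rho> z (c *s a) b = c * levi \<rho> z a b"
  "levi \<rho> z a (c *s b) = cnj c * levi \<rho> z a b"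
  by (simp_all add: levi_def sum_distrib_left algebra_simps)

lemma levi_commute:
  assumes "open S" "Ck_on 2 S \<rho>" "z \<in> S"
  shows "levi \<rho> z b a = cnj (levi \<rho> z a b)"
  by (simp add: levi_eq[OF assms] hessian_symmetric[OF assms, of b] hessian_symmetric[OF assms, of "\<i> *s b"]
      complex_eq_iff field_simps)

lemma Im_levi_diag:
  assumes "open S" "Ck_on 2 S \<rho>" "z \<in> S"
  shows "Im (levi \<rho> z a a) = 0"
  using levi_commute[OF assms, of a a] by (simp add: complex_eq_iff)

lemma Re_levi_expand:
  assumes "open S" "Ck_on 2 S \<rho>" "z \<in> S"
  shows "Re (levi \<rho> z (l + c *s n) (l + c *s n))
    = Re (levi \<rho> z l l) + 2 * Re (cnj c * levi \<rho> z l n) + (cmod c)\<^sup>2 * Re (levi \<rho> z n n)"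
  unfolding levi_add levi_scale levi_commute[OF assms, of n l] cmod_power2
  by (simp add: algebra_simps power2_eq_square Im_levi_diag[OF assms])

lemma vec10_diff: "vec10 (a - b) f z = vec10 a f z - vec10 b f z"
  by (simp add: vec10_def algebra_simps sum_subtractf)

lemma vec10_scale: "vec10 (c *s a) f z = c * vec10 a f z"
  by (simp add: vec10_def algebra_simps sum_distrib_left)

lemma inner_gradient:
  assumes "\<rho> differentiable (at z)"
  shows "gradient \<rho> z \<bullet> v = dderiv \<rho> v z"
proof -
  have lin: "linear (\<lambda>v. dderiv \<rho> v z)"
    using linear_frechet_derivative[OF assms] by simp
  have "gradient \<rho> z \<bullet> v = (\<Sum>b\<in>Basis. dderiv \<rho> b z * (b \<bullet> v))"
    by (simp add: gradient_def inner_sum_left)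
  also have "\<dots> = dderiv \<rho> (\<Sum>b\<in>Basis. (v \<bullet> b) *\<^sub>R b) z"
    by (simp add: linear_sum[OF lin] linear_scale[OF lin] inner_commute mult.commute)
  finally show ?thesis by (simp add: euclidean_representation)
qed

lemma gradient_nth:
  fixes \<rho> :: "complex^'n::finite \<Rightarrow> real"
  assumes "\<rho> differentiable (at z)"
  shows "gradient \<rho> z $ j = 2 * dzbar j (cpx \<rho>) z"
  using inner_gradient[OF assms, of "axis j 1"] inner_gradient[OF assms, of "axis j \<i>"]
  by (simp add: dzbar_cpx[OF assms] complex_eq_iff inner_axis inner_complex_def)

text \<open>The numbers \<open>2 * dzbar j (cpx \<rho>) z\<close>, read as a real vector, form the
  gradient. Hence at a boundary point \<open>N\<close>, taken as a real direction, is the outward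
  unit normal, and moving along it leaves the domain.\<close>

lemma normal10_eq:
  fixes \<rho> :: "complex^'n::finite \<Rightarrow> real"
  assumes "\<rho> differentiable (at z)"
  shows "normal10 \<rho> z = (1 / norm (gradient \<rho> z)) *\<^sub>R gradient \<rho> z"
proof -
  have "norm (gradient \<rho> z) = 2 * sqrt (\<Sum>k\<in>UNIV. (cmod (dz k (cpx \<rho>) z))\<^sup>2)"
    by (simp add: norm_vec_def L2_set_def gradient_nth[OF assms] dz_cpx[OF assms] norm_mult
        power_mult_distrib sum_distrib_left[symmetric] real_sqrt_mult)
  then show ?thesis
    by (simp add: vec_eq_iff normal10_def gradient_nth[OF assms] complex_eq_iff)
qed

lemma inner_ii_scale: "(v :: complex^'n::finite) \<bullet> (\<i> *s v) = 0"
  by (simp add: inner_vec_def inner_complex_def mult.commute)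

lemma vec10_gradient:
  fixes \<rho> :: "complex^'n::finite \<Rightarrow> real"
  assumes "\<rho> differentiable (at z)"
  shows "vec10 (gradient \<rho> z) (cpx \<rho>) z = of_real ((norm (gradient \<rho> z))\<^sup>2 / 2)"
  by (simp add: vec10_cpx[OF assms] inner_gradient[OF assms, symmetric] inner_ii_scale
      complex_eq_iff power2_norm_eq_inner)

text \<open>Removes the \<open>N\<close>-component; the factor 2 compensates
  \<open>vec10_gradient\<close>, where the gradient acts on \<open>\<rho>\<close> by half its
  squared norm. The inverse square is written with \<open>powr\<close> so that
  \<open>smooth_on_powr\<close> applies.\<close>

definition tangent_proj :: "(complex^'n::finite \<Rightarrow> real) \<Rightarrow> complex^'n \<Rightarrow> complex^'n \<Rightarrow> complex^'n" where
  "tangent_proj \<rho> z a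
     = a - (2 * vec10 a (cpx \<rho>) z * of_real ((norm (gradient \<rho> z))\<^sup>2 powr - 1)) *s gradient \<rho> z"

lemma gradient_eq_0_iff:
  assumes "\<rho> differentiable (at z)"
  shows "gradient \<rho> z = 0 \<longleftrightarrow> frechet_derivative \<rho> (at z) = (\<lambda>_. 0)"
  unfolding fun_eq_iff inner_gradient[OF assms, symmetric]
  using inner_eq_zero_iff[of "gradient \<rho> z"] by (auto simp del: inner_eq_zero_iff)

lemma vec10_tangent_proj:
  assumes "\<rho> differentiable (at z)" "gradient \<rho> z \<noteq> 0"
  shows "vec10 (tangent_proj \<rho> z a) (cpx \<rho>) z = 0"
  using assms(2) by (simp add: tangent_proj_def vec10_diff vec10_scale vec10_gradient[OF assms(1)]
      powr_minus complex_eq_iff)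

lemma tangent_normal_decomposition:
  assumes "\<rho> differentiable (at z)" "gradient \<rho> z \<noteq> 0"
  shows "a = tangent_proj \<rho> z a + (2 * vec10 a (cpx \<rho>) z / norm (gradient \<rho> z)) *s normal10 \<rho> z"
  using assms(2) unfolding tangent_proj_def normal10_eq[OF assms(1)]
  by (simp add: vec_eq_iff powr_minus scaleR_conv_of_real[where 'a=complex] power2_eq_square field_simps)

section \<open>Independence of the defining function\<close>

lemma tendsto_quotient_first_order:
  fixes \<rho> :: "'a::euclidean_space \<Rightarrow> real"
  assumes "\<rho> differentiable (at p)" "\<rho> p = 0"
  shows "((\<lambda>t. \<rho> (p + t *\<^sub>R v) / t) \<longlongrightarrow> dderiv \<rho> v p) (at_right 0)"
  using has_real_derivative_along_line[of \<rho> p 0 v] assms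
  by (auto simp: DERIV_def filterlim_at_split)

text \<open>Along a parabola whose velocity \<open>v\<close> is tangential, \<open>\<rho>\<close>
  changes only at second order, and the free vector \<open>w\<close> shifts the coefficient by
  \<open>dderiv \<rho> w p\<close>. L'Hospital's rule reduces this to a difference quotient of
  \<open>dderiv \<rho> v\<close>.\<close>

lemma tendsto_quotient_second_order:
  fixes \<rho> :: "'a::euclidean_space \<Rightarrow> real"
  assumes S: "open S" "Ck_on 2 S \<rho>" "p \<in> S" and p: "\<rho> p = 0" "dderiv \<rho> v p = 0"
  shows "((\<lambda>t. \<rho> (p + t *\<^sub>R v + t\<^sup>2 *\<^sub>R w) / t\<^sup>2) \<longlongrightarrow>
    (dderiv (dderiv \<rho> v) v p + 2 * dderiv \<rho> w p) / 2) (at_right 0)"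
proof -
  note d = Ck_on_2_differentiable[OF S(2)]
  define q where "q = (\<lambda>t. p + t *\<^sub>R v + t\<^sup>2 *\<^sub>R w)"
  have q: "(q has_derivative (\<lambda>h. h *\<^sub>R (v + (2 * t) *\<^sub>R w))) (at t)" for t
    unfolding q_def by (auto intro!: derivative_eq_intros simp: algebra_simps)
  have [simp]: "q 0 = p" by (simp add: q_def)
  have q0: "(q \<longlongrightarrow> p) (at_right 0)"
    using has_derivative_continuous[OF q, of 0] by (auto simp: continuous_within filterlim_at_split)
  have inS: "\<forall>\<^sub>F t in at_right 0. q t \<in> S"
    using topological_tendstoD[OF q0 S(1,3)] .
  have \<phi>: "((\<lambda>t. \<rho> (q t)) has_real_derivative dderiv \<rho> v (q t) + 2 * t * dderiv \<rho> w (q t)) (at t)" if "q t \<in> S" for t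
    using has_derivative_compose[OF q differentiable_has_frechet_derivative[OF d(1)[OF that]]]
    by (simp add: has_field_derivative_def dderiv_linear[OF d(1)[OF that]] mult.commute[of _ "_ + _"])
  have c: "isCont \<rho> p" "isCont (dderiv \<rho> w) p"
    using d[OF S(3)] differentiable_imp_continuous_within by blast+
  have "(dderiv \<rho> v has_derivative frechet_derivative (dderiv \<rho> v) (at p)) (at (q 0))"
    using differentiable_has_frechet_derivative[OF d(2)[OF S(3)]] by simp
  from has_derivative_compose[OF q[of 0] this]
  have "((\<lambda>t. dderiv \<rho> v (q t)) has_real_derivative dderiv (dderiv \<rho> v) v p) (at 0)"
    by (simp add: has_field_derivative_def dderiv_linear[OF d(2)[OF S(3)]] mult.commute[of _ "dderiv (dderiv \<rho> v) v p"])
  then have "((\<lambda>t. dderiv \<rho> v (q t) / t) \<longlongrightarrow> dderiv (dderiv \<rho> v) v p) (at_right 0)"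
    by (auto simp: DERIV_def p filterlim_at_split)
  then have l: "((\<lambda>t. (dderiv \<rho> v (q t) / t) / 2 + dderiv \<rho> w (q t)) \<longlongrightarrow>
      dderiv (dderiv \<rho> v) v p / 2 + dderiv \<rho> w p) (at_right 0)"
    by (intro tendsto_intros isCont_tendsto_compose[OF c(2) q0]) auto
  have "((\<lambda>t. \<rho> (q t) / t\<^sup>2) \<longlongrightarrow> dderiv (dderiv \<rho> v) v p / 2 + dderiv \<rho> w p) (at_right 0)"
  proof (rule lhopital_right_0)
    show "((\<lambda>t. \<rho> (q t)) \<longlongrightarrow> 0) (at_right 0)"
      using isCont_tendsto_compose[OF c(1) q0] p by simp
    show "((\<lambda>t::real. t\<^sup>2) \<longlongrightarrow> 0) (at_right 0)"
      by (rule tendsto_eq_intros refl | simp)+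
    show "\<forall>\<^sub>F t in at_right 0. ((\<lambda>t. \<rho> (q t)) has_real_derivative dderiv \<rho> v (q t) + 2 * t * dderiv \<rho> w (q t)) (at t)"
      using inS by eventually_elim (rule \<phi>)
    show "\<forall>\<^sub>F t in at_right 0. ((\<lambda>t::real. t\<^sup>2) has_real_derivative 2 * t) (at t)"
      by (auto intro!: always_eventually derivative_eq_intros)
    show "\<forall>\<^sub>F t::real in at_right 0. t\<^sup>2 \<noteq> 0" "\<forall>\<^sub>F t::real in at_right 0. 2 * t \<noteq> 0"
      by (auto simp: eventually_at_right_less eventually_at_filter)
    show "((\<lambda>t. (dderiv \<rho> v (q t) + 2 * t * dderiv \<rho> w (q t)) / (2 * t)) \<longlongrightarrow>
      dderiv (dderiv \<rho> v) v p / 2 + dderiv \<rho> w p) (at_right 0)"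
      by (rule Lim_transform_eventually[OF l]) (auto simp: eventually_at_filter field_simps)
  qed
  then show ?thesis by (simp add: q_def add_divide_distrib)
qed

lemma nonpos_if_le_all_eps:
  fixes A B :: real
  assumes "\<And>e. 0 < e \<Longrightarrow> A \<le> e * B"
  shows "A \<le> 0"
proof (cases "B \<le> 0")
  case True
  then show ?thesis using assms[of 1] by simp
next
  case False
  then show ?thesis using assms[of "A / (2 * B)"] by (cases "0 < A") auto
qed

lemma defining_function_props:
  assumes "open \<Omega>" and V: "open V" "closure \<Omega> \<subseteq> V" "smooth_on V \<rho>" "\<Omega> = {z\<in>V. \<rho> z < 0}"
    "\<forall>p\<in>frontier \<Omega>. frechet_derivative \<rho> (at p) \<noteq> (\<lambda>_. 0)" and p: "p \<in> frontier \<Omega>"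
  shows "p \<in> V" "\<rho> p = 0" "gradient \<rho> p \<noteq> 0"
proof -
  show pV: "p \<in> V" using p V(2) by (auto simp: frontier_def)
  have "p \<in> closure \<Omega>" "p \<notin> \<Omega>" using p assms(1) by (auto simp: frontier_def interior_open)
  obtain X where X: "\<And>n. X n \<in> \<Omega>" "X \<longlonglongrightarrow> p"
    using \<open>p \<in> closure \<Omega>\<close> closure_sequential by blast
  have "(\<lambda>n. \<rho> (X n)) \<longlonglongrightarrow> \<rho> p"
    using isCont_tendsto_compose[OF smooth_on_isCont[OF V(3) pV] X(2)] .
  moreover have "\<rho> (X n) \<le> 0" for n using X(1)[of n] V(4) by auto
  ultimately have "\<rho> p \<le> 0" by (metis LIMSEQ_le_const2)
  moreover have "\<not> \<rho> p < 0" using \<open>p \<notin> \<Omega>\<close> V(4) pV by auto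
  ultimately show "\<rho> p = 0" by simp
  show "gradient \<rho> p \<noteq> 0"
    using gradient_eq_0_iff[OF smooth_on_differentiable[OF V(3) pV]] V(5) p by auto
qed

lemma parallel_of_half_space:
  fixes g h :: "'a::real_inner"
  assumes "g \<noteq> 0" "h \<noteq> 0" and half: "\<And>w. g \<bullet> w < 0 \<Longrightarrow> h \<bullet> w \<le> 0"
  obtains c where "0 < c" "h = c *\<^sub>R g"
proof -
  define c where "c = (h \<bullet> g) / (g \<bullet> g)"
  define w where "w = h - c *\<^sub>R g"
  have gg: "0 < g \<bullet> g" using assms(1) by simp
  have gw: "g \<bullet> w = 0" using gg by (simp add: w_def c_def inner_diff_right inner_commute)
  \<comment> \<open>\<open>w\<close>, the part of \<open>h\<close> orthogonal to \<open>g\<close>,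
    lies on the edge of the half space; subtracting \<open>e *\<^sub>R g\<close> pushes it inside,
    and \<open>e\<close> then tends to 0.\<close>
  have "h \<bullet> w \<le> e * (h \<bullet> g)" if "0 < e" for e
    using half[of "w - e *\<^sub>R g"] gw gg that by (simp add: inner_diff_right)
  then have "h \<bullet> w \<le> 0" by (rule nonpos_if_le_all_eps)
  moreover have "w \<bullet> w = h \<bullet> w - c * (g \<bullet> w)"
    by (subst (1) w_def) (simp add: inner_diff_left)
  ultimately have "w \<bullet> w \<le> 0" using gw by simp
  then have "w = 0" using inner_gt_zero_iff[of w] by linarith
  then have h: "h = c *\<^sub>R g" by (simp add: w_def)
  have "0 \<le> h \<bullet> g" using half[of "- g"] gg by simp
  then have "0 \<le> c" by (simp add: c_def)
  with h assms(2) have "0 < c" by (cases "c = 0") auto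
  with h show ?thesis using that by blast
qed

text \<open>Curves that enter the set \<open>\<rho> < 0\<close> to second order also enter \<open>\<rho>' < 0\<close>; this compares the
  Hessians on the tangent space without parametrising the boundary.\<close>

lemma hessian_comparison:
  fixes \<rho> \<rho>' :: "'a::euclidean_space \<Rightarrow> real"
  assumes V: "open V" "Ck_on 2 V \<rho>" "p \<in> V" "\<rho> p = 0" "gradient \<rho> p \<noteq> 0"
    and V': "open V'" "Ck_on 2 V' \<rho>'" "p \<in> V'" "\<rho>' p = 0" "gradient \<rho>' p \<noteq> 0"
    and sub: "{z\<in>V. \<rho> z < 0} \<subseteq> {z\<in>V'. \<rho>' z < 0}"
  obtains c where "0 < c" "gradient \<rho>' p = c *\<^sub>R gradient \<rho> p"
    "\<And>v. dderiv \<rho> v p = 0 \<Longrightarrow> dderiv (dderiv \<rho>' v) v p \<le> c * dderiv (dderiv \<rho> v) v p"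
proof -
  note d = Ck_on_2_differentiable(1)[OF V(2,3)] Ck_on_2_differentiable(1)[OF V'(2,3)]
  have inV: "\<forall>\<^sub>F t in at_right 0. p + t *\<^sub>R v + t\<^sup>2 *\<^sub>R w \<in> V" for v w
  proof -
    have "((\<lambda>t. p + t *\<^sub>R v + t\<^sup>2 *\<^sub>R w) \<longlongrightarrow> p) (at_right 0)"
      by (rule tendsto_eq_intros refl | simp)+
    then show ?thesis using topological_tendstoD V(1,3) by blast
  qed
  have "gradient \<rho>' p \<bullet> w \<le> 0" if w: "gradient \<rho> p \<bullet> w < 0" for w
  proof -
    have "\<forall>\<^sub>F t in at_right 0. \<rho> (p + t *\<^sub>R w) / t < 0"
      using order_tendstoD(2)[OF tendsto_quotient_first_order[OF d(1) V(4)], of w 0] w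
      by (simp add: inner_gradient[OF d(1)])
    then have "\<forall>\<^sub>F t in at_right 0. \<rho>' (p + t *\<^sub>R w) / t \<le> 0"
      using inV[of w 0] eventually_at_right_less[of "0::real"]
    proof eventually_elim
      case (elim t)
      then have "p + t *\<^sub>R w \<in> {z\<in>V. \<rho> z < 0}" by (simp add: divide_less_0_iff)
      then show ?case using sub elim(3) by (auto simp: divide_le_0_iff)
    qed
    from tendsto_upperbound[OF tendsto_quotient_first_order[OF d(2) V'(4)] this]
    show ?thesis by (simp add: inner_gradient[OF d(2)])
  qed
  then obtain c where c: "0 < c" "gradient \<rho>' p = c *\<^sub>R gradient \<rho> p"
    using parallel_of_half_space[OF V(5) V'(5)] by blast
  have cd: "dderiv \<rho>' v p = c * dderiv \<rho> v p" for v
    using c(2) by (metis inner_gradient[OF d(1)] inner_gradient[OF d(2)] inner_scaleR_left)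
  have "dderiv (dderiv \<rho>' v) v p \<le> c * dderiv (dderiv \<rho> v) v p" if v: "dderiv \<rho> v p = 0" for v
  proof -
    let ?G = "gradient \<rho> p" and ?Q = "dderiv (dderiv \<rho> v) v p" and ?Q' = "dderiv (dderiv \<rho>' v) v p"
    have v': "dderiv \<rho>' v p = 0" using v cd by simp
    have GG: "0 < ?G \<bullet> ?G" using V(5) by simp
    have "?Q' - c * ?Q \<le> e * c" if e: "0 < e" for e
    proof -
      \<comment> \<open>A multiple of the gradient tuned so that \<open>\<rho>\<close> divided by
        \<open>t\<^sup>2\<close> tends to \<open>- e / 2\<close> along the curve, which therefore
        enters \<open>\<rho> < 0\<close>.\<close>
      define w where "w = ((- ?Q - e) / (2 * (?G \<bullet> ?G))) *\<^sub>R ?G"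
      have w: "2 * dderiv \<rho> w p = - ?Q - e"
        using GG by (simp add: w_def inner_gradient[OF d(1), symmetric])
      have "\<forall>\<^sub>F t in at_right 0. \<rho> (p + t *\<^sub>R v + t\<^sup>2 *\<^sub>R w) / t\<^sup>2 < 0"
        using order_tendstoD(2)[OF tendsto_quotient_second_order[OF V(1-4) v], of w 0] w e by simp
      then have "\<forall>\<^sub>F t in at_right 0. \<rho>' (p + t *\<^sub>R v + t\<^sup>2 *\<^sub>R w) / t\<^sup>2 \<le> 0"
        using inV[of v w] eventually_at_right_less[of "0::real"]
      proof eventually_elim
        case (elim t)
        then have "p + t *\<^sub>R v + t\<^sup>2 *\<^sub>R w \<in> {z\<in>V. \<rho> z < 0}" by (simp add: divide_less_0_iff)
        then show ?case using sub elim(3) by (auto simp: divide_le_0_iff)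
      qed
      from tendsto_upperbound[OF tendsto_quotient_second_order[OF V'(1-4) v'] this]
      have "?Q' + c * (2 * dderiv \<rho> w p) \<le> 0" by (simp add: cd)
      then show ?thesis unfolding w by (simp add: algebra_simps)
    qed
    then have "?Q' - c * ?Q \<le> 0" by (rule nonpos_if_le_all_eps)
    then show ?thesis by simp
  qed
  with c show ?thesis using that by blast
qed

text \<open>The definition of pseudoconvexity provides one good defining function
  \<open>\<rho>'\<close>. Its gradient is a positive multiple of that of \<open>\<rho>\<close>, so
  the complex tangent space is the same, and the Hessian comparison applied to \<open>a\<close> and
  to \<open>\<i> *s a\<close> carries the sign over.\<close>

lemma pseudoconvex_levi_nonneg:
  assumes \<Omega>: "open \<Omega>" "pseudoconvex \<Omega>" and \<rho>: "defining_function \<Omega> \<rho>"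
    and p: "p \<in> frontier \<Omega>" and a: "vec10 a (cpx \<rho>) p = 0"
  shows "0 \<le> Re (levi \<rho> p a a)"
proof -
  obtain \<rho>' where \<rho>': "defining_function \<Omega> \<rho>'"
    and psc: "\<And>a. vec10 a (cpx \<rho>') p = 0 \<Longrightarrow> 0 \<le> Re (levi \<rho>' p a a)"
    using \<Omega>(2) p unfolding pseudoconvex_def by blast
  obtain V where V: "open V" "closure \<Omega> \<subseteq> V" "smooth_on V \<rho>" "\<Omega> = {z\<in>V. \<rho> z < 0}"
    "\<forall>p\<in>frontier \<Omega>. frechet_derivative \<rho> (at p) \<noteq> (\<lambda>_. 0)"
    using \<rho> unfolding defining_function_def by blast
  obtain V' where V': "open V'" "closure \<Omega> \<subseteq> V'" "smooth_on V' \<rho>'" "\<Omega> = {z\<in>V'. \<rho>' z < 0}"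
    "\<forall>p\<in>frontier \<Omega>. frechet_derivative \<rho>' (at p) \<noteq> (\<lambda>_. 0)"
    using \<rho>' unfolding defining_function_def by blast
  note P = defining_function_props[OF \<Omega>(1) V p] and P' = defining_function_props[OF \<Omega>(1) V' p]
  note C = V(1) smooth_on_imp_Ck_on[OF V(3)] P(1) and C' = V'(1) smooth_on_imp_Ck_on[OF V'(3)] P'(1)
  note d = smooth_on_differentiable[OF V(3) P(1)] smooth_on_differentiable[OF V'(3) P'(1)]
  obtain c where c: "0 < c" "gradient \<rho>' p = c *\<^sub>R gradient \<rho> p"
    "\<And>v. dderiv \<rho> v p = 0 \<Longrightarrow> dderiv (dderiv \<rho>' v) v p \<le> c * dderiv (dderiv \<rho> v) v p"
    using hessian_comparison[OF C P(2,3) C' P'(2,3)] V(4) V'(4) by blast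
  have z: "dderiv \<rho> a p = 0" "dderiv \<rho> (\<i> *s a) p = 0"
    using a by (auto simp: vec10_cpx[OF d(1)] complex_eq_iff)
  then have "gradient \<rho>' p \<bullet> a = 0" "gradient \<rho>' p \<bullet> (\<i> *s a) = 0"
    unfolding c(2) by (simp_all add: inner_gradient[OF d(1)])
  then have "vec10 a (cpx \<rho>') p = 0"
    by (simp add: vec10_cpx[OF d(2)] inner_gradient[OF d(2)] complex_eq_iff)
  then have "0 \<le> dderiv (dderiv \<rho>' a) a p + dderiv (dderiv \<rho>' (\<i> *s a)) (\<i> *s a) p"
    using psc[of a] by (simp add: levi_eq[OF C'])
  also have "\<dots> \<le> c * (dderiv (dderiv \<rho> a) a p + dderiv (dderiv \<rho> (\<i> *s a)) (\<i> *s a) p)"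
    using c(3)[OF z(1)] c(3)[OF z(2)] by (simp add: algebra_simps)
  finally show ?thesis using c(1) by (simp add: levi_eq[OF C] zero_le_mult_iff)
qed

section \<open>Tangential and normal components\<close>

lemma smooth_on_compose_linear:
  assumes "open S" "bounded_linear h" "smooth_on U f" "\<And>x. x \<in> S \<Longrightarrow> h x \<in> U"
  shows "smooth_on S (\<lambda>x. f (h x))"
  using smooth_on_affine[OF assms(1,2,3), of 0] assms(4) by simp

lemma smooth_on_dzbar_cpx:
  fixes \<rho> :: "complex^'n::finite \<Rightarrow> real"
  assumes "open U" "smooth_on U \<rho>"
  shows "smooth_on U (dzbar j (cpx \<rho>))"
proof (rule smooth_on_cong[OF assms(1)])
  show "smooth_on U (\<lambda>z. (of_real (dderiv \<rho> (axis j 1) z) + \<i> * of_real (dderiv \<rho> (axis j \<i>) z)) / 2)"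
    by (rule smooth_on_linear[OF assms(1) bounded_linear_divide] smooth_on_add[OF assms(1)]
        smooth_on_mult[OF assms(1)] smooth_on_const smooth_on_linear[OF assms(1) bounded_linear_of_real]
        smooth_on_dderiv[OF assms(2)])+
qed (simp add: dzbar_cpx smooth_on_differentiable[OF assms(2)])

lemma smooth_on_cnj: "open S \<Longrightarrow> smooth_on S f \<Longrightarrow> smooth_on S (\<lambda>x. cnj (f x))"
  by (rule smooth_on_linear[OF _ bounded_linear_cnj])

lemma smooth_on_vec_nth: "open S \<Longrightarrow> smooth_on S f \<Longrightarrow> smooth_on S (\<lambda>x. f x $ j)"
  by (rule smooth_on_linear[OF _ bounded_linear_vec_nth])

lemma smooth_on_dz:
  fixes f :: "complex^'n::finite \<Rightarrow> complex"
  assumes "open U" "smooth_on U f"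
  shows "smooth_on U (dz j f)"
  unfolding dz_def
  by (rule smooth_on_linear[OF assms(1) bounded_linear_divide] smooth_on_diff[OF assms(1)]
      smooth_on_mult[OF assms(1)] smooth_on_const smooth_on_dderiv[OF assms(2)])+

text \<open>The base point enters through a linear map \<open>h\<close>: the identity for vector
  fields on \<open>U\<close>, and \<open>fst\<close> when point and vector vary together.\<close>

lemma smooth_on_levi:
  fixes \<rho> :: "complex^'n::finite \<Rightarrow> real"
  assumes U: "open U" "smooth_on U \<rho>" and S: "open S" and h: "bounded_linear h" "\<And>x. x \<in> S \<Longrightarrow> h x \<in> U"
    and A: "smooth_on S A" and B: "smooth_on S B"
  shows "smooth_on S (\<lambda>x. levi \<rho> (h x) (A x) (B x))"
  unfolding levi_def
  by (rule smooth_on_sum[OF S] smooth_on_mult[OF S] smooth_on_cnj[OF S] smooth_on_vec_nth[OF S] A B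
      smooth_on_compose_linear[OF S h(1) _ h(2)] smooth_on_dz[OF U(1)] smooth_on_dzbar_cpx[OF U] | assumption)+

lemma smooth_on_vec10_cpx:
  fixes \<rho> :: "complex^'n::finite \<Rightarrow> real"
  assumes U: "open U" "smooth_on U \<rho>" and S: "open S" and h: "bounded_linear h" "\<And>x. x \<in> S \<Longrightarrow> h x \<in> U"
    and A: "smooth_on S A"
  shows "smooth_on S (\<lambda>x. vec10 (A x) (cpx \<rho>) (h x))"
  unfolding vec10_def
  by (rule smooth_on_sum[OF S] smooth_on_mult[OF S] smooth_on_vec_nth[OF S] A
      smooth_on_compose_linear[OF S h(1) _ h(2)] smooth_on_dz[OF U(1)]
      smooth_on_linear[OF U(1) bounded_linear_of_real] U | assumption)+

lemma smooth_on_gradient: 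
  assumes "open U" "smooth_on U \<rho>"
  shows "smooth_on U (gradient \<rho>)"
  unfolding gradient_def
  by (rule smooth_on_sum[OF assms(1)] smooth_on_linear[OF assms(1) bounded_linear_scaleR_left]
      smooth_on_dderiv[OF assms(2)])+

lemma smooth_on_norm_gradient_powr:
  assumes "open U" "smooth_on U \<rho>" "\<And>z. z \<in> U \<Longrightarrow> gradient \<rho> z \<noteq> 0"
  shows "smooth_on U (\<lambda>z. (norm (gradient \<rho> z))\<^sup>2 powr r)"
  unfolding power2_norm_eq_inner
  by (rule smooth_on_powr[OF assms(1)] smooth_on_bilinear[OF assms(1) bounded_bilinear_inner]
      smooth_on_gradient[OF assms(1,2)])+ (simp add: assms(3))

lemma smooth_on_tangent_proj:
  fixes \<rho> :: "complex^'n::finite \<Rightarrow> real"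
  assumes U: "open U" "smooth_on U \<rho>" "\<And>z. z \<in> U \<Longrightarrow> gradient \<rho> z \<noteq> 0"
    and S: "open S" and h: "bounded_linear h" "\<And>x. x \<in> S \<Longrightarrow> h x \<in> U"
    and A: "smooth_on S A"
  shows "smooth_on S (\<lambda>x. tangent_proj \<rho> (h x) (A x))"
proof (rule smooth_on_vec[OF S])
  fix j
  have 1: "smooth_on S (\<lambda>x. complex_of_real ((norm (gradient \<rho> (h x)))\<^sup>2 powr - 1))"
    by (rule smooth_on_linear[OF S bounded_linear_of_real]
        smooth_on_compose_linear[OF S h(1) smooth_on_norm_gradient_powr[OF U] h(2)] | assumption)+
  have 2: "smooth_on S (\<lambda>x. gradient \<rho> (h x) $ j)"
    by (rule smooth_on_vec_nth[OF S] smooth_on_compose_linear[OF S h(1) smooth_on_gradient[OF U(1,2)] h(2)] | assumption)+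
  have "smooth_on S (\<lambda>x. A x $ j - 2 * vec10 (A x) (cpx \<rho>) (h x) *
      complex_of_real ((norm (gradient \<rho> (h x)))\<^sup>2 powr - 1) * gradient \<rho> (h x) $ j)"
    by (rule smooth_on_diff[OF S] smooth_on_vec_nth[OF S A] smooth_on_mult[OF S] smooth_on_const
        smooth_on_vec10_cpx[OF U(1,2) S h A] 1 2 | assumption)+
  then show "smooth_on S (\<lambda>x. tangent_proj \<rho> (h x) (A x) $ j)"
    by (simp add: tangent_proj_def)
qed

lemma smooth_on_normal10:
  fixes \<rho> :: "complex^'n::finite \<Rightarrow> real"
  assumes U: "open U" "smooth_on U \<rho>" "\<And>z. z \<in> U \<Longrightarrow> gradient \<rho> z \<noteq> 0"
  shows "smooth_on U (normal10 \<rho>)"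
proof (rule smooth_on_cong[OF U(1)])
  show "smooth_on U (\<lambda>z. ((norm (gradient \<rho> z))\<^sup>2 powr - (1/2)) *\<^sub>R gradient \<rho> z)"
    by (rule smooth_on_bilinear[OF U(1) bounded_bilinear_scaleR] smooth_on_norm_gradient_powr[OF U]
      smooth_on_gradient[OF U(1,2)] | assumption)+
  show "((norm (gradient \<rho> z))\<^sup>2 powr - (1/2)) *\<^sub>R gradient \<rho> z = normal10 \<rho> z" if "z \<in> U" for z
  proof -
    have "(norm (gradient \<rho> z))\<^sup>2 powr - (1/2) = 1 / norm (gradient \<rho> z)"
      by (simp add: powr_minus powr_half_sqrt inverse_eq_divide)
    then show ?thesis by (simp only: normal10_eq[OF smooth_on_differentiable[OF U(2) that]])
  qed
qed

text \<open>The form \<open>\<L>\<^sub>\<rho>(a,a) + c |a\<rho>|\<^sup>2 / \<rho>\<close> is, up to a positive factor, the Levi form of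
  \<open>\<rho>\<^sup>c\<^sup>+\<^sup>1\<close>; its restriction to the complex line through \<open>N\<close> is a quadratic polynomial whose
  discriminant gives the two estimates below.\<close>

definition power_levi :: "(complex^'n::finite \<Rightarrow> real) \<Rightarrow> real \<Rightarrow> complex^'n \<Rightarrow> complex^'n \<Rightarrow> real" where
  "power_levi \<rho> c z a = Re (levi \<rho> z a a) + c / \<rho> z * (cmod (vec10 a (cpx \<rho>) z))\<^sup>2"

text \<open>The coefficient of \<open>(cmod \<beta>)\<^sup>2\<close> after multiplication by
  \<open>\<rho>\<close>, which removes the pole at the boundary: where \<open>\<rho>\<close>
  vanishes the value is \<open>c * (norm (gradient \<rho> z))\<^sup>2 / 4\<close>.\<close>

definition normal_coeff :: "(complex^'n::finite \<Rightarrow> real) \<Rightarrow> real \<Rightarrow> complex^'n \<Rightarrow> real" where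
  "normal_coeff \<rho> c z = \<rho> z * Re (levi \<rho> z (normal10 \<rho> z) (normal10 \<rho> z)) + c * (norm (gradient \<rho> z))\<^sup>2 / 4"

lemma vec10_normal10:
  fixes \<rho> :: "complex^'n::finite \<Rightarrow> real"
  assumes "\<rho> differentiable (at z)"
  shows "vec10 (normal10 \<rho> z) (cpx \<rho>) z = of_real (norm (gradient \<rho> z) / 2)"
proof -
  have "normal10 \<rho> z = of_real (1 / norm (gradient \<rho> z)) *s gradient \<rho> z"
    by (simp add: normal10_eq[OF assms] vec_eq_iff complex_eq_iff)
  then show ?thesis by (simp add: vec10_scale vec10_gradient[OF assms] power2_eq_square)
qed

lemma power_levi_expand:
  fixes \<rho> :: "complex^'n::finite \<Rightarrow> real"
  assumes S: "open S" "Ck_on 2 S \<rho>" "z \<in> S" and l: "vec10 l (cpx \<rho>) z = 0" and pos: "0 < \<rho> z"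
  shows "\<rho> z * power_levi \<rho> c z (l + \<beta> *s normal10 \<rho> z)
    = \<rho> z * Re (levi \<rho> z l l) + 2 * \<rho> z * Re (cnj \<beta> * levi \<rho> z l (normal10 \<rho> z))
      + (cmod \<beta>)\<^sup>2 * normal_coeff \<rho> c z"
proof -
  have "vec10 (l + \<beta> *s normal10 \<rho> z) (cpx \<rho>) z = \<beta> * of_real (norm (gradient \<rho> z) / 2)"
    using vec10_diff[of "l + \<beta> *s normal10 \<rho> z" l "cpx \<rho>" z] l
    by (simp add: vec10_scale vec10_normal10 Ck_on_2_differentiable[OF S(2,3)])
  then have "(cmod (vec10 (l + \<beta> *s normal10 \<rho> z) (cpx \<rho>) z))\<^sup>2 = (cmod \<beta>)\<^sup>2 * (norm (gradient \<rho> z))\<^sup>2 / 4"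
    by (simp only: norm_mult norm_of_real) (simp add: power_mult_distrib power_divide)
  then show ?thesis
    unfolding power_levi_def Re_levi_expand[OF S] normal_coeff_def
    using pos by (simp add: field_simps)
qed

lemma power_levi_nonneg_imp:
  fixes \<rho> :: "complex^'n::finite \<Rightarrow> real"
  assumes S: "open S" "Ck_on 2 S \<rho>" "z \<in> S" and l: "vec10 l (cpx \<rho>) z = 0" and pos: "0 < \<rho> z"
    and nn: "\<And>a. 0 \<le> power_levi \<rho> c z a" and A: "0 < normal_coeff \<rho> c z"
  shows "\<rho> z * (cmod (levi \<rho> z l (normal10 \<rho> z)))\<^sup>2 \<le> Re (levi \<rho> z l l) * normal_coeff \<rho> c z"
proof -
  let ?A = "normal_coeff \<rho> c z" and ?l = "levi \<rho> z l (normal10 \<rho> z)"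
  \<comment> \<open>\<open>- t\<close> times the mixed Levi term is the value of
    \<open>\<beta>\<close> that minimises the quadratic polynomial, so testing nonnegativity there
    loses nothing.\<close>
  define t where "t = \<rho> z / ?A"
  have "0 \<le> \<rho> z * power_levi \<rho> c z (l + (- of_real t * ?l) *s normal10 \<rho> z)"
    using nn pos by simp
  also have "\<dots> = \<rho> z * Re (levi \<rho> z l l) + 2 * \<rho> z * Re (cnj (- of_real t * ?l) * ?l)
      + (cmod (- of_real t * ?l))\<^sup>2 * ?A"
    by (rule power_levi_expand[OF S l pos])
  also have "Re (cnj (- of_real t * ?l) * ?l) = - t * (cmod ?l)\<^sup>2"
    unfolding cmod_power2 by (simp add: power2_eq_square algebra_simps)
  also have "(cmod (- of_real t * ?l))\<^sup>2 * ?A = t * \<rho> z * (cmod ?l)\<^sup>2"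
    unfolding norm_mult norm_minus_cancel norm_of_real power_mult_distrib
    using A by (simp add: t_def power2_eq_square)
  finally have "0 \<le> \<rho> z * (Re (levi \<rho> z l l) - t * (cmod ?l)\<^sup>2)"
    by (simp add: algebra_simps)
  then have "t * (cmod ?l)\<^sup>2 \<le> Re (levi \<rho> z l l)"
    using pos by (simp add: zero_le_mult_iff)
  then show ?thesis using A by (simp add: t_def field_simps)
qed

lemma power_levi_lower_bound:
  fixes \<rho> :: "complex^'n::finite \<Rightarrow> real" and a :: "complex^'n"
  assumes S: "open S" "Ck_on 2 S \<rho>" "z \<in> S" and G: "gradient \<rho> z \<noteq> 0" and pos: "0 < \<rho> z"
    and A: "0 < normal_coeff \<rho> c z"
  defines "l \<equiv> tangent_proj \<rho> z a"
  shows "Re (levi \<rho> z l l) * normal_coeff \<rho> c z - \<rho> z * (cmod (levi \<rho> z l (normal10 \<rho> z)))\<^sup>2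
    \<le> power_levi \<rho> c z a * normal_coeff \<rho> c z"
proof -
  note d = Ck_on_2_differentiable(1)[OF S(2,3)]
  let ?A = "normal_coeff \<rho> c z" and ?l = "levi \<rho> z l (normal10 \<rho> z)"
  obtain \<beta> where \<beta>: "a = l + \<beta> *s normal10 \<rho> z"
    using tangent_normal_decomposition[OF d G, of a] unfolding l_def by blast
  have l: "vec10 l (cpx \<rho>) z = 0" unfolding l_def by (rule vec10_tangent_proj[OF d G])
  \<comment> \<open>Completing the square at the same minimiser, now to bound the polynomial from
    below for every \<open>\<beta>\<close>.\<close>
  have "0 \<le> (cmod (of_real ?A * \<beta> + of_real (\<rho> z) * ?l))\<^sup>2" by simp
  also have "\<dots> = ?A * ((cmod \<beta>)\<^sup>2 * ?A + 2 * \<rho> z * Re (cnj \<beta> * ?l)) + (\<rho> z)\<^sup>2 * (cmod ?l)\<^sup>2"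
    unfolding cmod_power2 by (simp add: power2_eq_square algebra_simps)
  also have "\<dots> = ?A * (\<rho> z * power_levi \<rho> c z a - \<rho> z * Re (levi \<rho> z l l)) + (\<rho> z)\<^sup>2 * (cmod ?l)\<^sup>2"
    unfolding \<beta> power_levi_expand[OF S l pos] by simp
  also have "\<dots> = \<rho> z * (power_levi \<rho> c z a * ?A - (Re (levi \<rho> z l l) * ?A - \<rho> z * (cmod ?l)\<^sup>2))"
    by (simp add: power2_eq_square algebra_simps)
  finally show ?thesis using pos by (simp add: zero_le_mult_iff)
qed

text \<open>A substitute for nearest-point projection. As \<open>\<rho>\<close> increases along
  \<open>\<nu>\<close> at \<open>p\<close>, some \<open>p - t *\<^sub>R \<nu>\<close> with small
  \<open>t\<close> lies in the open set \<open>\<Omega>\<close>. So does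
  \<open>z - t *\<^sub>R \<nu>\<close> for \<open>z\<close> near \<open>p\<close>, and the connected
  segment from an exterior \<open>z\<close> to it must cross the frontier.\<close>

lemma exterior_foot_point:
  fixes \<rho> :: "'a::euclidean_space \<Rightarrow> real"
  assumes \<Omega>: "open \<Omega>" "open V" "\<Omega> = {z\<in>V. \<rho> z < 0}" and p: "p \<in> V" "\<rho> p = 0" "\<rho> differentiable (at p)"
    and \<nu>: "0 < dderiv \<rho> \<nu> p" and e: "0 < e"
  shows "\<forall>\<^sub>F z in nhds p. z \<notin> closure \<Omega> \<longrightarrow> (\<exists>s. 0 < s \<and> s < e \<and> z - s *\<^sub>R \<nu> \<in> frontier \<Omega>)"
proof -
  have "\<forall>\<^sub>F t in at_right 0. \<rho> (p + t *\<^sub>R (- \<nu>)) / t < 0"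
    using order_tendstoD(2)[OF tendsto_quotient_first_order[OF p(3,2)], of "- \<nu>" 0] \<nu>
    by (simp add: dderiv_linear[OF p(3)])
  moreover have "((\<lambda>t. p + t *\<^sub>R (- \<nu>)) \<longlongrightarrow> p) (at_right 0)"
    by (rule tendsto_eq_intros refl | simp)+
  then have "\<forall>\<^sub>F t in at_right 0. p + t *\<^sub>R (- \<nu>) \<in> V"
    using topological_tendstoD \<Omega>(2) p(1) by blast
  ultimately have "\<forall>\<^sub>F t in at_right 0. 0 < t \<and> t < e \<and> p - t *\<^sub>R \<nu> \<in> \<Omega>"
    using eventually_at_right_real[OF e]
    by eventually_elim (auto simp: \<Omega>(3) divide_less_0_iff)
  then obtain t where t: "0 < t" "t < e" "p - t *\<^sub>R \<nu> \<in> \<Omega>"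
    using eventually_happens trivial_limit_at_right_real by blast
  have "((\<lambda>z. z - t *\<^sub>R \<nu>) \<longlongrightarrow> p - t *\<^sub>R \<nu>) (nhds p)"
    by (intro tendsto_intros filterlim_ident)
  then have "\<forall>\<^sub>F z in nhds p. z - t *\<^sub>R \<nu> \<in> \<Omega>"
    using topological_tendstoD \<Omega>(1) t(3) by blast
  then show ?thesis
  proof eventually_elim
    case (elim z)
    show ?case
    proof
      assume z: "z \<notin> closure \<Omega>"
      then have "z \<in> closed_segment z (z - t *\<^sub>R \<nu>) - \<Omega>" "z - t *\<^sub>R \<nu> \<in> closed_segment z (z - t *\<^sub>R \<nu>) \<inter> \<Omega>"
        using elim closure_subset[of \<Omega>] by auto
      then obtain x where x: "x \<in> closed_segment z (z - t *\<^sub>R \<nu>)" "x \<in> frontier \<Omega>"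
        using connected_Int_frontier[of "closed_segment z (z - t *\<^sub>R \<nu>)" \<Omega>] by auto
      then obtain u where u: "0 \<le> u" "u \<le> 1" "x = (1 - u) *\<^sub>R z + u *\<^sub>R (z - t *\<^sub>R \<nu>)"
        by (auto simp: closed_segment_def)
      have xu: "x = z - (u * t) *\<^sub>R \<nu>" using u(3) by (simp add: algebra_simps)
      have "u \<noteq> 0" using x(2) z xu by (auto simp: frontier_def)
      then have "0 < u * t" "u * t \<le> t"
        using u t mult_left_le_one_le[of t u] by auto
      then have "0 < u * t" "u * t < e" using t by linarith+
      then show "\<exists>s. 0 < s \<and> s < e \<and> z - s *\<^sub>R \<nu> \<in> frontier \<Omega>"
        using x(2) xu by blast
    qed
  qed
qed

section \<open>From plurisubharmonic powers to admissibility\<close>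

lemma Re_levi_diag:
  fixes \<rho> :: "complex^'n::finite \<Rightarrow> real"
  assumes "open S" "Ck_on 2 S \<rho>" "z \<in> S"
  shows "Re (levi \<rho> z a a) = (dderiv (dderiv \<rho> a) a z + dderiv (dderiv \<rho> (\<i> *s a)) (\<i> *s a) z) / 4"
  by (simp add: levi_eq[OF assms])

lemma Re_levi_compose_real:
  fixes f :: "complex^'n::finite \<Rightarrow> real"
  assumes S: "open S" "Ck_on 2 S f" "z \<in> S" and T: "\<And>y. y \<in> S \<Longrightarrow> f y \<in> T"
    and g: "\<And>t. t \<in> T \<Longrightarrow> (g has_real_derivative g' t) (at t)"
    and g': "\<And>t. t \<in> T \<Longrightarrow> (g' has_real_derivative g'' t) (at t)"
    and C: "Ck_on 2 S (\<lambda>y. g (f y))"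
  shows "Re (levi (\<lambda>y. g (f y)) z a a)
    = g' (f z) * Re (levi f z a a) + g'' (f z) * (cmod (vec10 a (cpx f) z))\<^sup>2"
proof -
  have "dderiv (dderiv (\<lambda>y. g (f y)) v) v z = g' (f z) * dderiv (dderiv f v) v z + g'' (f z) * (dderiv f v z)\<^sup>2" for v
    by (rule hessian_compose_real[where T = T and S = S]) (use assms in auto)
  then show ?thesis
    unfolding Re_levi_diag[OF S(1) C S(3)] Re_levi_diag[OF S]
      cmod_vec10_cpx[OF Ck_on_2_differentiable(1)[OF S(2,3)]]
    by (simp add: field_simps)
qed

lemma Re_levi_powr:
  fixes \<rho> :: "complex^'n::finite \<Rightarrow> real"
  assumes S: "open S" "smooth_on S \<rho>" "z \<in> S" and pos: "\<And>y. y \<in> S \<Longrightarrow> 0 < \<rho> y"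
  shows "Re (levi (\<lambda>y. \<rho> y powr \<eta>) z a a) = \<eta> * \<rho> z powr (\<eta> - 1) * power_levi \<rho> (\<eta> - 1) z a"
proof -
  have "Re (levi (\<lambda>y. \<rho> y powr \<eta>) z a a) = \<eta> * \<rho> z powr (\<eta> - 1) * Re (levi \<rho> z a a)
      + \<eta> * ((\<eta> - 1) * \<rho> z powr (\<eta> - 1 - 1)) * (cmod (vec10 a (cpx \<rho>) z))\<^sup>2"
  proof (rule Re_levi_compose_real[where T = "{0<..}" and S = S])
    show "Ck_on 2 S (\<lambda>y. \<rho> y powr \<eta>)"
      by (rule smooth_on_imp_Ck_on[OF smooth_on_powr[OF S(1,2) pos]])
    show "((\<lambda>t. t powr \<eta>) has_real_derivative \<eta> * t powr (\<eta> - 1)) (at t)" if "t \<in> {0<..}" for t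
      using that by (auto intro!: derivative_eq_intros)
    show "((\<lambda>t. \<eta> * t powr (\<eta> - 1)) has_real_derivative \<eta> * ((\<eta> - 1) * t powr (\<eta> - 1 - 1))) (at t)"
      if "t \<in> {0<..}" for t
      using that by (auto intro!: derivative_eq_intros)
  qed (use S pos smooth_on_imp_Ck_on in auto)
  moreover have "\<rho> z powr (\<eta> - 1 - 1) = \<rho> z powr (\<eta> - 1) / \<rho> z"
    using pos[OF S(3)] by (simp only: powr_diff[of _ "\<eta> - 1" 1] powr_one)
  ultimately show ?thesis by (simp add: power_levi_def algebra_simps diff_divide_distrib)
qed

text \<open>Hermitian symmetry makes the Levi function real on all of \<open>U\<close>, so the real
  part of a (1,0) derivative is half the derivative in the real direction \<open>n\<close>. This
  turns \<open>N\<close>-derivatives into difference quotients along the normal.\<close>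

lemma Re_vec10_levi:
  fixes \<rho> :: "complex^'n::finite \<Rightarrow> real"
  assumes U: "open U" "smooth_on U \<rho>" "smooth_on U L" "p \<in> U"
  shows "Re (vec10 n (\<lambda>z. levi \<rho> z (L z) (L z)) p) = dderiv (\<lambda>z. Re (levi \<rho> z (L z) (L z))) n p / 2"
    "smooth_on U (\<lambda>z. Re (levi \<rho> z (L z) (L z)))"
proof -
  have s: "smooth_on U (\<lambda>z. levi \<rho> z (L z) (L z))"
    using smooth_on_levi[OF U(1,2,1) bounded_linear_ident _ U(3,3)] by simp
  then show r: "smooth_on U (\<lambda>z. Re (levi \<rho> z (L z) (L z)))"
    by (rule smooth_on_linear[OF U(1) bounded_linear_Re])
  have "frechet_derivative (\<lambda>z. levi \<rho> z (L z) (L z)) (at p)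
      = frechet_derivative (cpx (\<lambda>z. Re (levi \<rho> z (L z) (L z)))) (at p)"
    by (rule frechet_derivative_transform_within_open[OF smooth_on_differentiable[OF s U(4)] U(1,4)])
      (simp add: complex_eq_iff Im_levi_diag[OF U(1) smooth_on_imp_Ck_on[OF U(2)]])
  then have "vec10 n (\<lambda>z. levi \<rho> z (L z) (L z)) p = vec10 n (cpx (\<lambda>z. Re (levi \<rho> z (L z) (L z)))) p"
    by (simp add: vec10_def dz_def)
  then show "Re (vec10 n (\<lambda>z. levi \<rho> z (L z) (L z)) p) = dderiv (\<lambda>z. Re (levi \<rho> z (L z) (L z))) n p / 2"
    by (simp add: vec10_cpx[OF smooth_on_differentiable[OF r U(4)]])
qed

text \<open>Clearing denominators exhibits admissibility as the boundary limit of the discriminant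
  condition: \<open>(\<eta> - 1) * g\<^sup>2 / 4\<close> is \<open>normal_coeff\<close> on the
  boundary, and \<open>D / 2\<close> is the form supplied by \<open>Re_vec10_levi\<close>.\<close>

lemma admissible_term_iff:
  fixes g l D \<eta> :: real
  assumes "0 < g" "1 < \<eta>"
  shows "1 / (\<eta> - 1) * (l / g\<^sup>2) - 1 / 2 * ((D / 2) / g) \<le> 0 \<longleftrightarrow> g * l \<le> D * ((\<eta> - 1) * g\<^sup>2 / 4)"
  using assms by (auto simp: field_simps power2_eq_square)

lemma norm_normal10:
  fixes \<rho> :: "complex^'n::finite \<Rightarrow> real"
  assumes "\<rho> differentiable (at z)" "gradient \<rho> z \<noteq> 0"
  shows "norm (normal10 \<rho> z) = 1" "dderiv \<rho> (normal10 \<rho> z) z = norm (gradient \<rho> z)"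
  using assms(2) by (simp_all add: normal10_eq[OF assms(1)] inner_gradient[OF assms(1), symmetric]
      power2_norm_eq_inner[symmetric] power2_eq_square)

lemma isCont_normal_coeff:
  fixes \<rho> :: "complex^'n::finite \<Rightarrow> real"
  assumes U: "open U" "smooth_on U \<rho>" "\<And>z. z \<in> U \<Longrightarrow> gradient \<rho> z \<noteq> 0" and p: "p \<in> U"
  shows "isCont (normal_coeff \<rho> c) p"
proof -
  note sN = smooth_on_normal10[OF U]
  have "smooth_on U (\<lambda>z. levi \<rho> z (normal10 \<rho> z) (normal10 \<rho> z))"
    using smooth_on_levi[OF U(1,2,1) bounded_linear_ident _ sN sN] by simp
  from smooth_on_isCont[OF this p] have "isCont (\<lambda>z. Re (levi \<rho> z (normal10 \<rho> z) (normal10 \<rho> z))) p"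
    by (rule isCont_Re)
  with smooth_on_isCont[OF U(2) p] smooth_on_isCont[OF smooth_on_gradient[OF U(1,2)] p]
  show ?thesis unfolding normal_coeff_def by (intro continuous_intros) auto
qed

lemma eta_admissible_if_power_psh:
  fixes \<rho> :: "complex^'n::finite \<Rightarrow> real"
  assumes \<Omega>: "open \<Omega>" and \<rho>: "defining_function \<Omega> \<rho>" and \<eta>: "1 < \<eta>"
    and U': "open U'" "frontier \<Omega> \<subseteq> U'" "strictly_psh_on (- closure \<Omega> \<inter> U') (\<lambda>z. \<rho> z powr \<eta>)"
  shows "eta_admissible \<Omega> \<rho> \<eta>"
  unfolding eta_admissible_def
proof (intro allI impI ballI)
  fix U L p
  assume T: "tangent_field \<Omega> \<rho> U L" and p: "p \<in> levi_null_set \<Omega> \<rho> L"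
  obtain V where V: "open V" "closure \<Omega> \<subseteq> V" "smooth_on V \<rho>" "\<Omega> = {z\<in>V. \<rho> z < 0}"
    "\<forall>p\<in>frontier \<Omega>. frechet_derivative \<rho> (at p) \<noteq> (\<lambda>_. 0)"
    using \<rho> unfolding defining_function_def by blast
  have pf: "p \<in> frontier \<Omega>" and l0: "levi \<rho> p (L p) (L p) = 0" using p by (auto simp: levi_null_set_def)
  have U: "open U" "smooth_on U \<rho>" "smooth_on U L" "p \<in> U"
    and nz: "\<And>z. z \<in> U \<Longrightarrow> gradient \<rho> z \<noteq> 0" and tan: "\<And>z. z \<in> U \<Longrightarrow> vec10 (L z) (cpx \<rho>) z = 0"
    using T pf unfolding tangent_field_def boundary_nbhd_def
    by (auto simp: gradient_eq_0_iff smooth_on_differentiable)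
  note P = defining_function_props[OF \<Omega> V pf]
  note d = smooth_on_differentiable[OF U(2,4)]
  define \<nu> where "\<nu> = normal10 \<rho> p"
  define F where "F = (\<lambda>z. Re (levi \<rho> z (L z) (L z)))"
  define A where "A = normal_coeff \<rho> (\<eta> - 1)"
  define q where "q = (\<lambda>s. p + s *\<^sub>R \<nu>)"
  let ?l = "\<lambda>z. (cmod (levi \<rho> z (L z) (normal10 \<rho> z)))\<^sup>2"
  let ?g = "norm (gradient \<rho> p)"
  have g: "0 < ?g" using P(3) by simp
  have D\<nu>: "dderiv \<rho> \<nu> p = ?g" using norm_normal10[OF d P(3)] by (simp add: \<nu>_def)
  have sF: "smooth_on U F" unfolding F_def by (rule Re_vec10_levi[OF U])
  have sN: "smooth_on U (normal10 \<rho>)" by (rule smooth_on_normal10[OF U(1,2) nz])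
  have "smooth_on U (\<lambda>z. levi \<rho> z (L z) (normal10 \<rho> z))"
    using smooth_on_levi[OF U(1,2,1) bounded_linear_ident _ U(3) sN] by simp
  then have cl: "isCont ?l p" using smooth_on_isCont U(4) by (intro continuous_intros) blast
  have cA: "isCont A p" unfolding A_def by (rule isCont_normal_coeff[OF U(1,2) nz U(4)])
  have Ap: "A p = (\<eta> - 1) * ?g\<^sup>2 / 4" by (simp add: A_def normal_coeff_def P(2))
  have q: "(q \<longlongrightarrow> p) (at_right 0)" unfolding q_def by (rule tendsto_eq_intros refl | simp)+
  have "0 < A p" using g \<eta> by (simp add: Ap)
  then have ev: "\<forall>\<^sub>F s in at_right 0. 0 < A (q s)" "\<forall>\<^sub>F s in at_right 0. q s \<in> U"
      "\<forall>\<^sub>F s in at_right 0. q s \<in> V" "\<forall>\<^sub>F s in at_right 0. q s \<in> U'"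
    using order_tendstoD(1)[OF isCont_tendsto_compose[OF cA q]] topological_tendstoD[OF q] U V P(1) U' pf
    by blast+
  have quot: "((\<lambda>s. \<rho> (q s) / s) \<longlongrightarrow> ?g) (at_right 0)"
    using tendsto_quotient_first_order[OF d P(2), of \<nu>] by (simp add: q_def D\<nu>)
  have F0: "F p = 0" by (simp add: F_def l0)
  have quotF: "((\<lambda>s. F (q s) / s) \<longlongrightarrow> dderiv F \<nu> p) (at_right 0)"
    unfolding q_def by (rule tendsto_quotient_first_order[OF smooth_on_differentiable[OF sF U(4)] F0])
  \<comment> \<open>The discriminant condition at \<open>q s\<close>, divided by \<open>s\<close>.
    Both \<open>\<rho>\<close> and \<open>F\<close> vanish at \<open>p\<close>, the latter because
    \<open>p\<close> is a null point, so the quotients tend to normal derivatives and admissibility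
    is the limiting inequality.\<close>
  have "\<forall>\<^sub>F s in at_right 0. \<rho> (q s) / s * ?l (q s) \<le> F (q s) / s * A (q s)"
    using ev order_tendstoD(1)[OF quot g] eventually_at_right_less[of "0::real"]
  proof eventually_elim
    case (elim s)
    let ?z = "q s"
    define S where "S = {z \<in> U \<inter> V. 0 < \<rho> z}"
    have S: "open S"
    proof -
      have "S = (U \<inter> V) \<inter> \<rho> -` {0<..}" by (auto simp: S_def)
      moreover have "continuous_on (U \<inter> V) \<rho>"
        using smooth_on_isCont[OF U(2)] by (auto intro!: continuous_at_imp_continuous_on)
      ultimately show ?thesis using U(1) V(1) continuous_open_preimage[of "U \<inter> V" \<rho> "{0<..}"] by auto
    qed
    have pos: "0 < \<rho> ?z" using elim by (simp add: zero_less_divide_iff)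
    have zS: "?z \<in> S" using elim pos by (simp add: S_def)
    have "?z \<notin> closure \<Omega>"
    proof
      assume "?z \<in> closure \<Omega>"
      then have "?z \<in> \<Omega> \<or> ?z \<in> frontier \<Omega>" by (auto simp: frontier_def interior_open[OF \<Omega>])
      then show False using pos V(4) defining_function_props(2)[OF \<Omega> V, of ?z] by auto
    qed
    then have psh: "0 < Re (levi (\<lambda>z. \<rho> z powr \<eta>) ?z a a)" if "a \<noteq> 0" for a
      using U'(3) elim that by (auto simp: strictly_psh_on_def)
    have nn: "0 \<le> power_levi \<rho> (\<eta> - 1) ?z a" for a
    proof (cases "a = 0")
      case True
      then show ?thesis by (simp add: power_levi_def levi_def vec10_def)
    next
      case False
      have "Re (levi (\<lambda>z. \<rho> z powr \<eta>) ?z a a) = \<eta> * \<rho> ?z powr (\<eta> - 1) * power_levi \<rho> (\<eta> - 1) ?z a"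
        by (rule Re_levi_powr[OF S smooth_on_subset[OF U(2)] zS]) (auto simp: S_def)
      then have "0 < \<eta> * \<rho> ?z powr (\<eta> - 1) * power_levi \<rho> (\<eta> - 1) ?z a"
        using psh[OF False] by simp
      moreover have "0 < \<eta> * \<rho> ?z powr (\<eta> - 1)" using \<eta> pos by simp
      ultimately show ?thesis using zero_less_mult_pos less_imp_le by blast
    qed
    have "\<rho> ?z * ?l ?z \<le> F ?z * A ?z"
      unfolding F_def A_def
      using power_levi_nonneg_imp[OF U(1) smooth_on_imp_Ck_on[OF U(2)] _ tan pos nn] elim by (simp add: A_def)
    then show ?case using elim by (simp add: divide_right_mono)
  qed
  then have "?g * ?l p \<le> dderiv F \<nu> p * A p"
    by (rule tendsto_le[OF trivial_limit_at_right_real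
          tendsto_mult[OF quotF isCont_tendsto_compose[OF cA q]] tendsto_mult[OF quot isCont_tendsto_compose[OF cl q]]])
  then show "1 / (\<eta> - 1) * ((cmod (levi \<rho> p (L p) (normal10 \<rho> p)))\<^sup>2 / (norm (gradient \<rho> p))\<^sup>2)
         - 1 / 2 * (Re (vec10 (normal10 \<rho> p) (\<lambda>z. levi \<rho> z (L z) (L z)) p) / norm (gradient \<rho> p)) \<le> 0"
    unfolding Re_vec10_levi(1)[OF U] admissible_term_iff[OF g \<eta>]
    by (simp add: F_def \<nu>_def Ap)
qed

text \<open>Spreads a local property over the whole segment from an exterior point to its foot
  point, as the mean value theorem requires, with the vector component frozen. Starting within
  \<open>e / 2\<close> of the centre and moving less than \<open>e / 2\<close> keeps the segment in
  the \<open>e\<close>-ball.\<close>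

lemma exterior_segment:
  fixes \<rho> :: "'a::euclidean_space \<Rightarrow> real" and a0 :: "'b::euclidean_space"
  assumes \<Omega>: "open \<Omega>" "open V" "\<Omega> = {z\<in>V. \<rho> z < 0}" and p: "p \<in> V" "\<rho> p = 0" "\<rho> differentiable (at p)"
    and \<nu>: "0 < dderiv \<rho> \<nu> p" "norm \<nu> = 1" and P: "\<forall>\<^sub>F x in nhds (p, a0). P x"
  shows "\<forall>\<^sub>F x in nhds (p, a0). fst x \<notin> closure \<Omega> \<longrightarrow>
    (\<exists>s>0. fst x - s *\<^sub>R \<nu> \<in> frontier \<Omega> \<and> (\<forall>t. 0 \<le> t \<and> t \<le> s \<longrightarrow> P (fst x - t *\<^sub>R \<nu>, snd x)))"
proof -
  obtain e where e: "0 < e" "\<And>x. dist x (p, a0) < e \<Longrightarrow> P x"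
    using P unfolding eventually_nhds_metric by blast
  have "\<forall>\<^sub>F z in nhds p. z \<notin> closure \<Omega> \<longrightarrow> (\<exists>s. 0 < s \<and> s < e / 2 \<and> z - s *\<^sub>R \<nu> \<in> frontier \<Omega>)"
    by (rule exterior_foot_point[OF \<Omega> p \<nu>(1)]) (use e in simp)
  moreover have "filterlim fst (nhds (fst (p, a0))) (nhds (p, a0))"
    by (rule tendsto_fst[OF filterlim_ident])
  then have "filterlim fst (nhds p) (nhds (p, a0))" by simp
  ultimately have "\<forall>\<^sub>F x in nhds (p, a0). fst x \<notin> closure \<Omega> \<longrightarrow>
      (\<exists>s. 0 < s \<and> s < e / 2 \<and> fst x - s *\<^sub>R \<nu> \<in> frontier \<Omega>)"
    by (rule eventually_compose_filterlim)
  moreover have "\<forall>\<^sub>F x in nhds (p, a0). dist x (p, a0) < e / 2"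
    using e(1) by (intro eventually_nhds_metric[THEN iffD2] exI[of _ "e / 2"]) auto
  ultimately show ?thesis
  proof eventually_elim
    case (elim x)
    show ?case
    proof
      assume "fst x \<notin> closure \<Omega>"
      then obtain s where s: "0 < s" "s < e / 2" "fst x - s *\<^sub>R \<nu> \<in> frontier \<Omega>" using elim by blast
      have "P (fst x - t *\<^sub>R \<nu>, snd x)" if t: "0 \<le> t" "t \<le> s" for t
      proof (rule e(2))
        have "dist (fst x - t *\<^sub>R \<nu>, snd x) x = norm (t *\<^sub>R \<nu>)"
          by (cases x) (simp add: dist_Pair_Pair dist_norm)
        also have "\<dots> < e / 2" using t s \<nu>(2) by simp
        finally show "dist (fst x - t *\<^sub>R \<nu>, snd x) (p, a0) < e"
          using elim(2) dist_triangle_half_r[of x _ e] by (metis dist_commute)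
      qed
      then show "\<exists>s>0. fst x - s *\<^sub>R \<nu> \<in> frontier \<Omega> \<and> (\<forall>t. 0 \<le> t \<and> t \<le> s \<longrightarrow> P (fst x - t *\<^sub>R \<nu>, snd x))"
        using s by blast
    qed
  qed
qed

section \<open>From admissibility to plurisubharmonic powers\<close>

lemma eventually_nhds_isCont_less:
  fixes f :: "'a::t2_space \<Rightarrow> real"
  assumes "isCont f x" "c < f x"
  shows "\<forall>\<^sub>F y in nhds x. c < f y"
  using order_tendstoD(1)[OF isCont_tendsto_nhds[OF assms(1)] assms(2)] .

text \<open>Multiplied by \<open>normal_coeff\<close>, the claim follows from
  \<open>0 \<le> F * A - \<rho> * lN + \<kappa> * \<rho> * A\<close>. If \<open>F\<close> is
  positive at \<open>(p, a0)\<close>, continuity suffices, because the other terms carry the factor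
  \<open>\<rho>\<close>. If it vanishes there, slopes with respect to the distance \<open>s\<close>
  to the foot point must be compared, which is what admissibility does.\<close>

lemma power_levi_bound_local:
  fixes \<rho> :: "complex^'n::finite \<Rightarrow> real" and a0 :: "complex^'n"
  assumes \<Omega>: "open \<Omega>" "pseudoconvex \<Omega>" and V: "open V" "closure \<Omega> \<subseteq> V" "smooth_on V \<rho>" "\<Omega> = {z\<in>V. \<rho> z < 0}"
    "\<forall>p\<in>frontier \<Omega>. frechet_derivative \<rho> (at p) \<noteq> (\<lambda>_. 0)"
    and \<eta>: "1 < \<eta>" "eta_admissible \<Omega> \<rho> \<eta>" and \<kappa>: "0 < \<kappa>" and pf: "p \<in> frontier \<Omega>"
  shows "\<forall>\<^sub>F x in nhds (p, a0). fst x \<in> V \<and> (fst x \<notin> closure \<Omega> \<longrightarrow>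
    0 < \<rho> (fst x) \<and> - \<kappa> * \<rho> (fst x) \<le> power_levi \<rho> (\<eta> - 1) (fst x) (snd x))"
proof -
  have \<rho>: "defining_function \<Omega> \<rho>" using V unfolding defining_function_def by blast
  note P = defining_function_props[OF \<Omega>(1) V pf]
  note sG = smooth_on_gradient[OF V(1,3)]
  define U where "U = {z\<in>V. gradient \<rho> z \<noteq> 0}"
  have U: "open U" "smooth_on U \<rho>" "\<And>z. z \<in> U \<Longrightarrow> gradient \<rho> z \<noteq> 0" "p \<in> U"
  proof -
    have "U = V \<inter> gradient \<rho> -` (- {0})" by (auto simp: U_def)
    moreover have "continuous_on V (gradient \<rho>)"
      using smooth_on_isCont[OF sG] by (auto intro!: continuous_at_imp_continuous_on)
    ultimately show "open U" using V(1) continuous_open_preimage[of V "gradient \<rho>" "- {0}"] by auto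
    show "smooth_on U \<rho>" using V(3) by (rule smooth_on_subset) (auto simp: U_def)
  qed (use P in \<open>auto simp: U_def\<close>)
  note C2 = U(1) smooth_on_imp_Ck_on[OF U(2), of 2]
  note d = smooth_on_differentiable[OF U(2,4)]
  let ?W = "U \<times> (UNIV :: (complex^'n) set)" and ?q = "(p, a0)"
  have W: "open ?W" "bounded_linear (fst :: (complex^'n) \<times> (complex^'n) \<Rightarrow> _)" "\<And>x. x \<in> ?W \<Longrightarrow> fst x \<in> U"
    and qW: "?q \<in> ?W"
    using U(1,4) bounded_linear_fst by (auto intro: open_Times)
  define \<nu> where "\<nu> = normal10 \<rho> p"
  define L where "L = (\<lambda>x. tangent_proj \<rho> (fst x) (snd x))"
  define F where "F = (\<lambda>x. Re (levi \<rho> (fst x) (L x) (L x)))"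
  define lN where "lN = (\<lambda>x. (cmod (levi \<rho> (fst x) (L x) (normal10 \<rho> (fst x))))\<^sup>2)"
  define A where "A = normal_coeff \<rho> (\<eta> - 1)"
  define DF where "DF = dderiv F (\<nu>, 0)"
  let ?g = "norm (gradient \<rho> p)"
  have g: "0 < ?g" using P(3) by simp
  have \<nu>: "dderiv \<rho> \<nu> p = ?g" "norm \<nu> = 1" using norm_normal10[OF d P(3)] by (simp_all add: \<nu>_def)
  have Ap: "A p = (\<eta> - 1) * ?g\<^sup>2 / 4" by (simp add: A_def normal_coeff_def P(2))
  have Apos: "0 < A p" unfolding Ap using g \<eta> by simp
  have sL: "smooth_on ?W L" unfolding L_def
    by (rule smooth_on_tangent_proj[OF U(1-3) W smooth_on_bounded_linear[OF W(1) bounded_linear_snd]])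
  have sF: "smooth_on ?W F" unfolding F_def
    by (rule smooth_on_linear[OF W(1) bounded_linear_Re smooth_on_levi[OF U(1,2) W sL sL]])
  have tan: "vec10 (L x) (cpx \<rho>) (fst x) = 0" if "fst x \<in> U" for x
    unfolding L_def by (rule vec10_tangent_proj[OF smooth_on_differentiable[OF U(2) that] U(3)[OF that]])
  have cA: "isCont (\<lambda>x. A (fst x)) ?q"
    using isCont_normal_coeff[OF U] by (intro isCont_o2[OF isCont_fst[OF continuous_ident]]) (simp add: A_def)
  have cl: "isCont lN ?q"
  proof -
    have "smooth_on ?W (\<lambda>x. levi \<rho> (fst x) (L x) (normal10 \<rho> (fst x)))"
      by (rule smooth_on_levi[OF U(1,2) W sL smooth_on_compose_linear[OF W(1,2) smooth_on_normal10[OF U(1-3)] W(3)]])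
    from smooth_on_isCont[OF this qW] show ?thesis unfolding lN_def by (intro continuous_intros)
  qed
  have c\<rho>: "isCont (\<lambda>x. \<rho> (fst x)) ?q"
    using smooth_on_isCont[OF U(2,4)] by (intro isCont_o2[OF isCont_fst[OF continuous_ident]]) simp
  have cD: "isCont (\<lambda>x. dderiv \<rho> \<nu> (fst x)) ?q"
    using smooth_on_isCont[OF smooth_on_dderiv[OF U(2)] U(4)] by (intro isCont_o2[OF isCont_fst[OF continuous_ident]]) simp
  have cDF: "isCont DF ?q" unfolding DF_def by (rule smooth_on_isCont[OF smooth_on_dderiv[OF sF] qW])
  have cF: "isCont F ?q" by (rule smooth_on_isCont[OF sF qW])

  \<comment> \<open>Common frame of the two cases: \<open>R\<close> is a neighbourhood condition at
    \<open>(p, a0)\<close>, and \<open>RH\<close> derives the discriminant inequality once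
    \<open>R\<close> holds along the whole segment to the foot point.\<close>
  have key: ?thesis
    if R: "\<forall>\<^sub>F x in nhds ?q. R x" and
      RH: "\<And>x s. 0 < s \<Longrightarrow> fst x - s *\<^sub>R \<nu> \<in> frontier \<Omega> \<Longrightarrow>
        (\<And>t. 0 \<le> t \<Longrightarrow> t \<le> s \<Longrightarrow> R (fst x - t *\<^sub>R \<nu>, snd x) \<and> fst x - t *\<^sub>R \<nu> \<in> U
            \<and> 0 < A (fst x - t *\<^sub>R \<nu>) \<and> 0 < dderiv \<rho> \<nu> (fst x - t *\<^sub>R \<nu>)) \<Longrightarrow>
        0 < \<rho> (fst x) \<Longrightarrow> 0 \<le> F x * A (fst x) - \<rho> (fst x) * lN x + \<kappa> * \<rho> (fst x) * A (fst x)" for R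
  proof -
    have "\<forall>\<^sub>F x in nhds ?q. fst x \<in> U"
      using W(1,3) qW by (auto intro!: eventually_nhds[THEN iffD2])
    then have "\<forall>\<^sub>F x in nhds ?q. R x \<and> fst x \<in> U \<and> 0 < A (fst x) \<and> 0 < dderiv \<rho> \<nu> (fst x)"
      using R eventually_nhds_isCont_less[OF cA, of 0] eventually_nhds_isCont_less[OF cD, of 0] Apos g
      by (simp add: \<nu> eventually_conj_iff)
    from exterior_segment[OF \<Omega>(1) V(1,4) P(1,2) d _ \<nu>(2) this] this g \<nu>(1)
    have "\<forall>\<^sub>F x in nhds ?q. (fst x \<notin> closure \<Omega> \<longrightarrow>
      (\<exists>s>0. fst x - s *\<^sub>R \<nu> \<in> frontier \<Omega> \<and> (\<forall>t. 0 \<le> t \<and> t \<le> s \<longrightarrow> 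
        R (fst x - t *\<^sub>R \<nu>, snd x) \<and> fst x - t *\<^sub>R \<nu> \<in> U
            \<and> 0 < A (fst x - t *\<^sub>R \<nu>) \<and> 0 < dderiv \<rho> \<nu> (fst x - t *\<^sub>R \<nu>)))) \<and> fst x \<in> U"
      by (auto simp: eventually_conj_iff)
    then show ?thesis
    proof (rule eventually_mono)
      fix x
      assume x: "(fst x \<notin> closure \<Omega> \<longrightarrow>
      (\<exists>s>0. fst x - s *\<^sub>R \<nu> \<in> frontier \<Omega> \<and> (\<forall>t. 0 \<le> t \<and> t \<le> s \<longrightarrow> 
        R (fst x - t *\<^sub>R \<nu>, snd x) \<and> fst x - t *\<^sub>R \<nu> \<in> U
            \<and> 0 < A (fst x - t *\<^sub>R \<nu>) \<and> 0 < dderiv \<rho> \<nu> (fst x - t *\<^sub>R \<nu>)))) \<and> fst x \<in> U"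
      show "fst x \<in> V \<and> (fst x \<notin> closure \<Omega> \<longrightarrow>
        0 < \<rho> (fst x) \<and> - \<kappa> * \<rho> (fst x) \<le> power_levi \<rho> (\<eta> - 1) (fst x) (snd x))"
      proof (intro conjI[of "fst x \<in> V"] impI)
        show "fst x \<in> V" using x by (simp add: U_def)
        assume "fst x \<notin> closure \<Omega>"
        then obtain s where s: "0 < s" "fst x - s *\<^sub>R \<nu> \<in> frontier \<Omega>"
          "\<And>t. 0 \<le> t \<Longrightarrow> t \<le> s \<Longrightarrow> R (fst x - t *\<^sub>R \<nu>, snd x) \<and> fst x - t *\<^sub>R \<nu> \<in> U
            \<and> 0 < A (fst x - t *\<^sub>R \<nu>) \<and> 0 < dderiv \<rho> \<nu> (fst x - t *\<^sub>R \<nu>)"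
          using x by blast
        \<comment> \<open>\<open>\<rho>\<close> vanishes at the foot point and increases strictly
          along the segment, so it is positive at the exterior point.\<close>
        have "\<rho> (fst x + (- s) *\<^sub>R \<nu>) < \<rho> (fst x + 0 *\<^sub>R \<nu>)"
          using s(1) 
        proof (intro DERIV_pos_imp_increasing[of "- s" 0 "\<lambda>t. \<rho> (fst x + t *\<^sub>R \<nu>)"] exI conjI)
          fix t :: real assume "- s \<le> t" "t \<le> 0"
          then have t: "fst x + t *\<^sub>R \<nu> \<in> U" "0 < dderiv \<rho> \<nu> (fst x + t *\<^sub>R \<nu>)"
            using s(3)[of "- t"] by auto
          show "((\<lambda>t. \<rho> (fst x + t *\<^sub>R \<nu>)) has_real_derivative dderiv \<rho> \<nu> (fst x + t *\<^sub>R \<nu>)) (at t)"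
            by (rule has_real_derivative_along_line[OF smooth_on_differentiable[OF U(2) t(1)]])
          show "0 < dderiv \<rho> \<nu> (fst x + t *\<^sub>R \<nu>)" by (rule t)
        qed auto
        then have pos: "0 < \<rho> (fst x)" using defining_function_props(2)[OF \<Omega>(1) V s(2)] by simp
        have xU: "fst x \<in> U" and xA: "0 < A (fst x)" using s(3)[of 0] s(1) by auto
        have "0 \<le> F x * A (fst x) - \<rho> (fst x) * lN x + \<kappa> * \<rho> (fst x) * A (fst x)"
          by (rule RH[OF s pos])
        also have "\<dots> \<le> power_levi \<rho> (\<eta> - 1) (fst x) (snd x) * A (fst x) + \<kappa> * \<rho> (fst x) * A (fst x)"
          using power_levi_lower_bound[OF C2 xU U(3)[OF xU] pos, of "\<eta> - 1" "snd x"] xA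
          by (simp add: F_def lN_def L_def A_def)
        also have "\<dots> = (power_levi \<rho> (\<eta> - 1) (fst x) (snd x) + \<kappa> * \<rho> (fst x)) * A (fst x)"
          by (simp add: algebra_simps)
        finally show "0 < \<rho> (fst x) \<and> - \<kappa> * \<rho> (fst x) \<le> power_levi \<rho> (\<eta> - 1) (fst x) (snd x)"
          using xA pos by (simp add: zero_le_mult_iff)
      qed
    qed
  qed

  have Fnn: "0 \<le> F x" if "fst x \<in> frontier \<Omega>" "fst x \<in> U" for x
    unfolding F_def by (rule pseudoconvex_levi_nonneg[OF \<Omega> \<rho> that(1) tan[OF that(2)]])
  show ?thesis
  proof (cases "F ?q = 0")
    case False
    then have "0 < F ?q" using Fnn[of ?q] pf U(4) by simp
    then have "0 < F ?q * A (fst ?q) - \<rho> (fst ?q) * lN ?q + \<kappa> * \<rho> (fst ?q) * A (fst ?q)"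
      using Apos P(2) by simp
    moreover have "isCont (\<lambda>x. F x * A (fst x) - \<rho> (fst x) * lN x + \<kappa> * \<rho> (fst x) * A (fst x)) ?q"
      by (intro continuous_intros cF cA c\<rho> cl)
    ultimately have "\<forall>\<^sub>F x in nhds ?q. 0 < F x * A (fst x) - \<rho> (fst x) * lN x + \<kappa> * \<rho> (fst x) * A (fst x)"
      using eventually_nhds_isCont_less by fast
    then show ?thesis
    proof (rule key)
      fix x s assume s: "(0::real) < s" and *: "\<And>t. 0 \<le> t \<Longrightarrow> t \<le> s \<Longrightarrow>
        0 < F (fst x - t *\<^sub>R \<nu>, snd x) * A (fst (fst x - t *\<^sub>R \<nu>, snd x))
         - \<rho> (fst (fst x - t *\<^sub>R \<nu>, snd x)) * lN (fst x - t *\<^sub>R \<nu>, snd x)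
         + \<kappa> * \<rho> (fst (fst x - t *\<^sub>R \<nu>, snd x)) * A (fst (fst x - t *\<^sub>R \<nu>, snd x)) \<and>
        fst x - t *\<^sub>R \<nu> \<in> U \<and> 0 < A (fst x - t *\<^sub>R \<nu>) \<and> 0 < dderiv \<rho> \<nu> (fst x - t *\<^sub>R \<nu>)"
      show "0 \<le> F x * A (fst x) - \<rho> (fst x) * lN x + \<kappa> * \<rho> (fst x) * A (fst x)"
        using *[of 0] s by simp
    qed
  next
    case True
    \<comment> \<open>Projecting the constant vector \<open>a0\<close> gives a tangent field on
      \<open>U\<close>, a legitimate test field for admissibility at \<open>p\<close>; as
      \<open>a0\<close> is frozen, the normal derivative of its Levi form is \<open>DF\<close> at
      \<open>(p, a0)\<close>.\<close>
    define l where "l = (\<lambda>z. tangent_proj \<rho> z a0)"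
    have sl: "smooth_on U l" unfolding l_def
      using smooth_on_tangent_proj[OF U(1-3) U(1) bounded_linear_ident _ smooth_on_const] by simp
    have "tangent_field \<Omega> \<rho> U l"
      unfolding tangent_field_def boundary_nbhd_def
    proof (intro conjI ballI U sl)
      show "frontier \<Omega> \<subseteq> U" using defining_function_props(1,3)[OF \<Omega>(1) V] by (auto simp: U_def)
      show "frechet_derivative \<rho> (at z) \<noteq> (\<lambda>_. 0)" if "z \<in> U" for z
        using U(3)[OF that] gradient_eq_0_iff[OF smooth_on_differentiable[OF U(2) that]] by simp
      show "vec10 (l z) (cpx \<rho>) z = 0" if "z \<in> U" for z
        using tan[of "(z, a0)"] that by (simp add: l_def L_def)
    qed
    moreover have "p \<in> levi_null_set \<Omega> \<rho> l"
      using True Im_levi_diag[OF C2 U(4)] pf by (simp add: levi_null_set_def F_def L_def l_def complex_eq_iff)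
    ultimately have "1 / (\<eta> - 1) * ((cmod (levi \<rho> p (l p) (normal10 \<rho> p)))\<^sup>2 / ?g\<^sup>2)
         - 1 / 2 * (Re (vec10 (normal10 \<rho> p) (\<lambda>z. levi \<rho> z (l z) (l z)) p) / ?g) \<le> 0"
      using \<eta>(2) unfolding eta_admissible_def by blast
    then have "?g * (cmod (levi \<rho> p (l p) (normal10 \<rho> p)))\<^sup>2
        \<le> dderiv (\<lambda>z. Re (levi \<rho> z (l z) (l z))) \<nu> p * A p"
      unfolding Re_vec10_levi(1)[OF U(1,2) sl U(4)] admissible_term_iff[OF g \<eta>(1)] by (simp add: \<nu>_def Ap)
    moreover have "((\<lambda>z. (z, a0)) has_derivative (\<lambda>v. (v, 0))) (at p)"
      by (auto intro!: derivative_eq_intros)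
    from frechet_derivative_eq[OF has_derivative_compose[OF this smooth_on_has_derivative[OF sF qW]]]
    have "dderiv (\<lambda>z. Re (levi \<rho> z (l z) (l z))) \<nu> p = DF ?q"
      by (simp add: F_def L_def l_def DF_def)
    ultimately have adm: "?g * lN ?q \<le> DF ?q * A p" by (simp add: lN_def L_def l_def)
    \<comment> \<open>Three separate arguments, since the endpoint and the two intermediate points
      that the mean value theorem gives for \<open>F\<close> and for \<open>\<rho>\<close> may
      differ. At the triple \<open>(?q, ?q, ?q)\<close> admissibility and the
      \<open>\<kappa>\<close> term make \<open>\<Phi>\<close> strictly positive.\<close>
    define \<Phi> where "\<Phi> = (\<lambda>(x, y, w :: (complex^'n) \<times> (complex^'n)). DF y * A (fst x) - dderiv \<rho> \<nu> (fst w) * lN x + \<kappa> * dderiv \<rho> \<nu> (fst w) * A (fst x))"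
    have lim: "isCont (\<lambda>X. DF (fst (snd X)) * A (fst (fst X)) - dderiv \<rho> \<nu> (fst (snd (snd X))) * lN (fst X)
        + \<kappa> * dderiv \<rho> \<nu> (fst (snd (snd X))) * A (fst (fst X))) (?q, ?q, ?q)"
    proof -
      have "isCont (\<lambda>X. DF (fst (snd X))) (?q, ?q, ?q)"
        by (rule isCont_o2[where f = "\<lambda>X. fst (snd X)" and g = DF]) (auto simp: cDF intro!: continuous_intros)
      moreover have "isCont (\<lambda>X. A (fst (fst X))) (?q, ?q, ?q)"
        by (rule isCont_o2[where f = fst and g = "\<lambda>x. A (fst x)"]) (use cA in \<open>auto intro!: continuous_intros\<close>)
      moreover have "isCont (\<lambda>X. lN (fst X)) (?q, ?q, ?q)"
        by (rule isCont_o2[where f = fst and g = lN]) (auto simp: cl intro!: continuous_intros)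
      moreover have "isCont (\<lambda>X. dderiv \<rho> \<nu> (fst (snd (snd X)))) (?q, ?q, ?q)"
        by (rule isCont_o2[where f = "\<lambda>X. snd (snd X)" and g = "\<lambda>x. dderiv \<rho> \<nu> (fst x)"])
          (use cD in \<open>auto intro!: continuous_intros\<close>)
      ultimately show ?thesis by (intro continuous_intros)
    qed
    have "0 < \<kappa> * ?g * A p" using \<kappa> g Apos by simp
    then have "\<forall>\<^sub>F X in nhds (?q, ?q, ?q). 0 < \<Phi> X"
      unfolding \<Phi>_def case_prod_beta using adm
      by (intro eventually_nhds_isCont_less[OF lim]) (simp add: \<nu>(1))
    then obtain e where e: "0 < e" "\<And>X. dist X (?q, ?q, ?q) < e \<Longrightarrow> 0 < \<Phi> X"
      unfolding eventually_nhds_metric by blast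
    have near: "0 < \<Phi> (x, y, w)" if "dist x ?q < e / 3" "dist y ?q < e / 3" "dist w ?q < e / 3" for x y w
    proof (rule e(2))
      have "dist (x, y, w) (?q, ?q, ?q) \<le> dist x ?q + (dist y ?q + dist w ?q)"
        unfolding dist_Pair_Pair[of x "(y, w)"] dist_Pair_Pair[of y w]
        by (intro order.trans[OF sqrt_sum_squares_le_sum] add_left_mono) (auto simp: sqrt_sum_squares_le_sum)
      then show "dist (x, y, w) (?q, ?q, ?q) < e" using that by simp
    qed
    have "\<forall>\<^sub>F x in nhds ?q. dist x ?q < e / 3"
      using e(1) by (intro eventually_nhds_metric[THEN iffD2] exI[of _ "e / 3"]) auto
    then show ?thesis
    proof (rule key)
      fix x s
      assume s: "(0::real) < s" "fst x - s *\<^sub>R \<nu> \<in> frontier \<Omega>" and *: "\<And>t. 0 \<le> t \<Longrightarrow> t \<le> s \<Longrightarrow>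
        dist (fst x - t *\<^sub>R \<nu>, snd x) ?q < e / 3 \<and> fst x - t *\<^sub>R \<nu> \<in> U \<and>
        0 < A (fst x - t *\<^sub>R \<nu>) \<and> 0 < dderiv \<rho> \<nu> (fst x - t *\<^sub>R \<nu>)"
      have inU: "fst x + t *\<^sub>R \<nu> \<in> U" if "- s \<le> t" "t \<le> 0" for t
        using *[of "- t"] that by simp
      have "\<exists>t>- s. t < 0 \<and> \<rho> (fst x + 0 *\<^sub>R \<nu>) - \<rho> (fst x + (- s) *\<^sub>R \<nu>)
          = (0 - - s) * dderiv \<rho> \<nu> (fst x + t *\<^sub>R \<nu>)"
        by (rule MVT2) (use s in \<open>auto intro!: has_real_derivative_along_line smooth_on_differentiable[OF U(2)] inU\<close>)
      then obtain t where t: "- s < t" "t < 0" "\<rho> (fst x) = s * dderiv \<rho> \<nu> (fst x + t *\<^sub>R \<nu>)"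
        using defining_function_props(2)[OF \<Omega>(1) V s(2)] by auto
      have "\<exists>t>- s. t < 0 \<and> F (x + 0 *\<^sub>R (\<nu>, 0)) - F (x + (- s) *\<^sub>R (\<nu>, 0))
          = (0 - - s) * dderiv F (\<nu>, 0) (x + t *\<^sub>R (\<nu>, 0))"
      proof (rule MVT2)
        show "- s < 0" using s by simp
        show "((\<lambda>t. F (x + t *\<^sub>R (\<nu>, 0))) has_real_derivative dderiv F (\<nu>, 0) (x + t *\<^sub>R (\<nu>, 0))) (at t)"
          if "- s \<le> t" "t \<le> 0" for t
          by (rule has_real_derivative_along_line[OF smooth_on_differentiable[OF sF]])
            (simp add: mem_Times_iff inU[OF that])
      qed
      then obtain t' where t': "- s < t'" "t' < 0" "F x - F (x + (- s) *\<^sub>R (\<nu>, 0)) = s * DF (x + t' *\<^sub>R (\<nu>, 0))"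
        by (auto simp: DF_def zero_prod_def[symmetric])
      \<comment> \<open>Here pseudoconvexity enters at the foot point, which may lie outside the
        Levi null set: dropping this nonnegative value leaves \<open>F x\<close> bounded below by
        its slope times \<open>s\<close>.\<close>
      have "0 \<le> F (x + (- s) *\<^sub>R (\<nu>, 0))"
        using Fnn[of "x + (- s) *\<^sub>R (\<nu>, 0)"] s inU[of "- s"] by simp
      then have "s * DF (x + t' *\<^sub>R (\<nu>, 0)) \<le> F x" using t'(3) by linarith
      moreover have eqx: "x + r *\<^sub>R (\<nu>, 0) = (fst x - (- r) *\<^sub>R \<nu>, snd x)" for r
        by (simp add: prod_eq_iff)
      have "0 < \<Phi> (x, x + t' *\<^sub>R (\<nu>, 0), x + t *\<^sub>R (\<nu>, 0))"
        using near *[of 0] *[of "- t"] *[of "- t'"] s t t' unfolding eqx by simp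
      then have "0 \<le> s * (DF (x + t' *\<^sub>R (\<nu>, 0)) * A (fst x) - dderiv \<rho> \<nu> (fst x + t *\<^sub>R \<nu>) * lN x
          + \<kappa> * dderiv \<rho> \<nu> (fst x + t *\<^sub>R \<nu>) * A (fst x))"
        using s by (simp add: \<Phi>_def)
      then have "0 \<le> s * DF (x + t' *\<^sub>R (\<nu>, 0)) * A (fst x) - \<rho> (fst x) * lN x + \<kappa> * \<rho> (fst x) * A (fst x)"
        unfolding t(3) by (simp add: algebra_simps)
      moreover have "0 < A (fst x)" using *[of 0] s by simp
      ultimately show "0 \<le> F x * A (fst x) - \<rho> (fst x) * lN x + \<kappa> * \<rho> (fst x) * A (fst x)"
        using mult_right_mono[of "s * DF (x + t' *\<^sub>R (\<nu>, 0))" "F x" "A (fst x)"] by linarith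
    qed
  qed
qed

section \<open>Multiplying the defining function by a Gaussian factor\<close>

lemma hessian_mult:
  fixes f g :: "'a::euclidean_space \<Rightarrow> real"
  assumes S: "open S" "Ck_on 2 S f" "Ck_on 2 S g" "x \<in> S"
  shows "dderiv (\<lambda>y. f y * g y) v x = f x * dderiv g v x + dderiv f v x * g x"
    "dderiv (dderiv (\<lambda>y. f y * g y) v) v x
      = f x * dderiv (dderiv g v) v x + 2 * dderiv f v x * dderiv g v x + dderiv (dderiv f v) v x * g x"
proof -
  note df = Ck_on_2_differentiable[OF S(2), THEN differentiable_has_frechet_derivative]
  note dg = Ck_on_2_differentiable[OF S(3), THEN differentiable_has_frechet_derivative]
  have 1: "dderiv (\<lambda>y. f y * g y) v y = f y * dderiv g v y + dderiv f v y * g y" if "y \<in> S" for y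
    by (simp add: frechet_derivative_eq[OF has_derivative_mult[OF df(1)[OF that] dg(1)[OF that]]])
  show "dderiv (\<lambda>y. f y * g y) v x = f x * dderiv g v x + dderiv f v x * g x" by (rule 1[OF S(4)])
  have "((\<lambda>y. f y * dderiv g v y + dderiv f v y * g y) has_derivative
     (\<lambda>w. (f x * dderiv (dderiv g v) w x + dderiv f w x * dderiv g v x)
        + (dderiv f v x * dderiv g w x + dderiv (dderiv f v) w x * g x))) (at x)"
    by (intro has_derivative_add has_derivative_mult df dg S)
  then have "(dderiv (\<lambda>y. f y * g y) v has_derivative
     (\<lambda>w. (f x * dderiv (dderiv g v) w x + dderiv f w x * dderiv g v x)
        + (dderiv f v x * dderiv g w x + dderiv (dderiv f v) w x * g x))) (at x)"
    by (rule has_derivative_transform_within_open[OF _ S(1,4)]) (simp add: 1)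
  then show "dderiv (dderiv (\<lambda>y. f y * g y) v) v x
      = f x * dderiv (dderiv g v) v x + 2 * dderiv f v x * dderiv g v x + dderiv (dderiv f v) v x * g x"
    by (simp add: frechet_derivative_eq algebra_simps)
qed

lemma gaussian_derivatives:
  fixes z :: "'a::euclidean_space"
  shows "smooth_on UNIV (\<lambda>y::'a. exp (\<delta> * (y \<bullet> y)))"
    "dderiv (\<lambda>y. exp (\<delta> * (y \<bullet> y))) v z = exp (\<delta> * (z \<bullet> z)) * (2 * \<delta> * (z \<bullet> v))"
    "dderiv (dderiv (\<lambda>y. exp (\<delta> * (y \<bullet> y))) v) v z
      = exp (\<delta> * (z \<bullet> z)) * ((2 * \<delta> * (z \<bullet> v))\<^sup>2 + 2 * \<delta> * (v \<bullet> v))"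
proof -
  let ?f = "\<lambda>y::'a. \<delta> * (y \<bullet> y)"
  have s: "smooth_on UNIV ?f"
    by (rule smooth_on_mult smooth_on_const smooth_on_bilinear[OF _ bounded_bilinear_inner]
        smooth_on_bounded_linear[OF _ bounded_linear_ident] open_UNIV)+
  then show "smooth_on UNIV (\<lambda>y::'a. exp (\<delta> * (y \<bullet> y)))" by (rule smooth_on_exp[OF open_UNIV])
  have f: "(?f has_derivative (\<lambda>w. 2 * \<delta> * (y \<bullet> w))) (at y)" for y
    by (auto intro!: derivative_eq_intros simp: inner_commute)
  have D: "dderiv ?f w = (\<lambda>y. 2 * \<delta> * (y \<bullet> w))" for w
    by (simp add: fun_eq_iff frechet_derivative_eq[OF f])
  have "((\<lambda>y. 2 * \<delta> * (y \<bullet> v)) has_derivative (\<lambda>w. 2 * \<delta> * (w \<bullet> v))) (at z)"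
    by (auto intro!: derivative_eq_intros)
  then have DD: "dderiv (dderiv ?f v) v z = 2 * \<delta> * (v \<bullet> v)"
    unfolding D by (simp add: frechet_derivative_eq)
  show "dderiv (\<lambda>y. exp (?f y)) v z = exp (?f z) * (2 * \<delta> * (z \<bullet> v))"
    by (subst frechet_derivative_eq[OF has_derivative_exp[OF f]]) simp
  have "dderiv (dderiv (\<lambda>y. exp (?f y)) v) v z
      = exp (?f z) * dderiv (dderiv ?f v) v z + exp (?f z) * (dderiv ?f v z)\<^sup>2"
    by (rule hessian_compose_real[where S = UNIV and T = UNIV])
      (auto intro: smooth_on_imp_Ck_on[OF s] DERIV_exp)
  then show "dderiv (dderiv (\<lambda>y. exp (?f y)) v) v z
      = exp (?f z) * ((2 * \<delta> * (z \<bullet> v))\<^sup>2 + 2 * \<delta> * (v \<bullet> v))"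
    by (simp only: DD) (simp add: frechet_derivative_eq[OF f] algebra_simps)
qed

text \<open>The factor is positive, so the sublevel set is unchanged; on the frontier
  \<open>\<rho>\<close> vanishes and the differential is merely rescaled.\<close>

lemma defining_function_mult_gaussian:
  assumes "open \<Omega>" "defining_function \<Omega> \<rho>"
  shows "defining_function \<Omega> (\<lambda>z. \<rho> z * exp (\<delta> * (z \<bullet> z)))"
proof -
  obtain V where V: "open V" "closure \<Omega> \<subseteq> V" "smooth_on V \<rho>" "\<Omega> = {z\<in>V. \<rho> z < 0}"
    "\<forall>p\<in>frontier \<Omega>. frechet_derivative \<rho> (at p) \<noteq> (\<lambda>_. 0)"
    using assms(2) unfolding defining_function_def by blast
  have sE: "smooth_on V (\<lambda>y. exp (\<delta> * (y \<bullet> y)))"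
    by (rule smooth_on_subset[OF gaussian_derivatives(1)]) simp
  have "frechet_derivative (\<lambda>z. \<rho> z * exp (\<delta> * (z \<bullet> z))) (at p) \<noteq> (\<lambda>_. 0)" if p: "p \<in> frontier \<Omega>" for p
  proof -
    note P = defining_function_props[OF assms(1) V p]
    have "dderiv (\<lambda>z. \<rho> z * exp (\<delta> * (z \<bullet> z))) v p = dderiv \<rho> v p * exp (\<delta> * (p \<bullet> p))" for v
      using hessian_mult(1)[OF V(1) smooth_on_imp_Ck_on[OF V(3)] smooth_on_imp_Ck_on[OF sE] P(1)] P(2) by simp
    then show ?thesis using V(5) p by (auto simp: fun_eq_iff)
  qed
  then show ?thesis
    unfolding defining_function_def
    using V smooth_on_mult[OF V(1,3) sE] by (intro exI[of _ V]) (auto simp: mult_less_0_iff)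
qed

text \<open>By Young's inequality the cross terms of the Gaussian factor cost \<open>O(\<delta>\<^sup>2)\<close> and the surplus
  \<open>\<eta>' - \<eta>\<close>, whereas its Levi form contributes at the order \<open>\<delta>\<close>.\<close>

lemma power_levi_mult_gaussian:
  fixes \<rho> :: "complex^'n::finite \<Rightarrow> real"
  assumes S: "open S" "smooth_on S \<rho>" "z \<in> S" and pos: "0 < \<rho> z"
    and \<eta>: "1 < \<eta>" "\<eta> < \<eta>'" and \<delta>: "0 < \<delta>" "4 * \<eta>'\<^sup>2 * R\<^sup>2 * \<delta> \<le> \<eta>' - \<eta>" and R: "norm z \<le> R"
  shows "exp (\<delta> * (z \<bullet> z)) * (power_levi \<rho> (\<eta> - 1) z a + \<delta> / 2 * \<rho> z * (norm a)\<^sup>2)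
    \<le> power_levi (\<lambda>z. \<rho> z * exp (\<delta> * (z \<bullet> z))) (\<eta>' - 1) z a"
proof -
  let ?h = "exp (\<delta> * (z \<bullet> z))" and ?\<rho>' = "\<lambda>z. \<rho> z * exp (\<delta> * (z \<bullet> z))"
  have sE: "smooth_on S (\<lambda>y. exp (\<delta> * (y \<bullet> y)))"
    by (rule smooth_on_subset[OF gaussian_derivatives(1)]) simp
  note C = S(1) smooth_on_imp_Ck_on[OF S(2)] S(3)
  note C' = S(1) smooth_on_imp_Ck_on[OF smooth_on_mult[OF S(1,2) sE]] S(3)
  note H = hessian_mult[OF S(1) smooth_on_imp_Ck_on[OF S(2)] smooth_on_imp_Ck_on[OF sE] S(3),
      unfolded gaussian_derivatives(3), unfolded gaussian_derivatives(2)]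
  \<comment> \<open>Proved along single real directions: four times \<open>power_levi\<close> is the
    sum over \<open>a\<close> and \<open>\<i> *s a\<close>, and the two gains of size
    \<open>\<delta>\<close> add up to the stated \<open>\<delta> / 2\<close>.\<close>
  have line: "?h * (dderiv (dderiv \<rho> v) v z + (\<eta> - 1) / \<rho> z * (dderiv \<rho> v z)\<^sup>2 + \<delta> * \<rho> z * (norm v)\<^sup>2)
    \<le> dderiv (dderiv ?\<rho>' v) v z + (\<eta>' - 1) / ?\<rho>' z * (dderiv ?\<rho>' v z)\<^sup>2" for v
  proof -
    define x where "x = dderiv \<rho> v z"
    define s where "s = z \<bullet> v"
    define r where "r = \<rho> z"
    define \<epsilon> where "\<epsilon> = \<eta>' - \<eta>"
    have r: "0 < r" and \<epsilon>: "0 < \<epsilon>" using pos \<eta> by (simp_all add: r_def \<epsilon>_def)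
    have "s\<^sup>2 \<le> R\<^sup>2 * (norm v)\<^sup>2"
    proof -
      have "\<bar>s\<bar> \<le> R * norm v"
        using Cauchy_Schwarz_ineq2[of z v] mult_right_mono[OF R norm_ge_zero[of v]] by (simp add: s_def)
      from power_mono[OF this abs_ge_zero, of 2] show ?thesis by (simp add: power_mult_distrib)
    qed
    then have "4 * \<eta>'\<^sup>2 * \<delta> * s\<^sup>2 \<le> 4 * \<eta>'\<^sup>2 * \<delta> * (R\<^sup>2 * (norm v)\<^sup>2)"
      using \<delta>(1) by (intro mult_left_mono) auto
    also have "\<dots> = (4 * \<eta>'\<^sup>2 * R\<^sup>2 * \<delta>) * (norm v)\<^sup>2" by simp
    also have "\<dots> \<le> \<epsilon> * (norm v)\<^sup>2"
      unfolding \<epsilon>_def by (intro mult_right_mono \<delta>(2)) simp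
    finally have 1: "4 * \<eta>'\<^sup>2 * \<delta> * s\<^sup>2 \<le> \<epsilon> * (norm v)\<^sup>2" .
    \<comment> \<open>Young's inequality as a square: its cross term is \<open>\<epsilon>\<close>
      times the mixed term of the Gaussian expansion, and the bound on \<open>\<delta>\<close> makes
      its last term at most
      \<open>\<epsilon> * \<delta> * r\<^sup>2 * (norm v)\<^sup>2\<close>.\<close>
    have "0 \<le> (\<epsilon> * x + 2 * \<delta> * \<eta>' * r * s)\<^sup>2" by simp
    also have "\<dots> = \<epsilon> * (\<epsilon> * x\<^sup>2 + 4 * \<delta> * \<eta>' * r * x * s) + \<delta> * r\<^sup>2 * (4 * \<eta>'\<^sup>2 * \<delta> * s\<^sup>2)"
      by (simp add: power2_eq_square algebra_simps)
    also have "\<dots> \<le> \<epsilon> * (\<epsilon> * x\<^sup>2 + 4 * \<delta> * \<eta>' * r * x * s) + \<delta> * r\<^sup>2 * (\<epsilon> * (norm v)\<^sup>2)"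
      using \<delta>(1) by (intro add_left_mono mult_left_mono 1) auto
    also have "\<dots> = \<epsilon> * (\<epsilon> * x\<^sup>2 + 4 * \<delta> * \<eta>' * r * x * s + \<delta> * r\<^sup>2 * (norm v)\<^sup>2)"
      by (simp add: algebra_simps)
    finally have 2: "0 \<le> \<epsilon> * x\<^sup>2 + 4 * \<delta> * \<eta>' * r * x * s + \<delta> * r\<^sup>2 * (norm v)\<^sup>2"
      using \<epsilon> by (simp add: zero_le_mult_iff)
    \<comment> \<open>Up to the factor \<open>?h\<close>, the Hessian of the Gaussian contributes
      \<open>2 * \<delta> * r * (norm v)\<^sup>2\<close>; half of it is kept as the gain, the other
      half is consumed by the inequality just shown.\<close>
    have "dderiv (dderiv ?\<rho>' v) v z + (\<eta>' - 1) / ?\<rho>' z * (dderiv ?\<rho>' v z)\<^sup>2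
      - ?h * (dderiv (dderiv \<rho> v) v z + (\<eta> - 1) / \<rho> z * (dderiv \<rho> v z)\<^sup>2 + \<delta> * \<rho> z * (norm v)\<^sup>2)
      = ?h / r * ((\<epsilon> * x\<^sup>2 + 4 * \<delta> * \<eta>' * r * x * s + \<delta> * r\<^sup>2 * (norm v)\<^sup>2) + 4 * \<delta>\<^sup>2 * \<eta>' * r\<^sup>2 * s\<^sup>2)"
      using r unfolding H x_def[symmetric] s_def[symmetric] r_def[symmetric] \<epsilon>_def power2_norm_eq_inner
      by (simp add: field_simps power2_eq_square)
    moreover have "0 \<le> ?h / r" "0 \<le> 4 * \<delta>\<^sup>2 * \<eta>' * r\<^sup>2 * s\<^sup>2" using r \<eta> by simp_all
    note mult_nonneg_nonneg[OF this(1) add_nonneg_nonneg[OF 2 this(2)]]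
    ultimately show ?thesis by linarith
  qed
  have na: "norm (\<i> *s a) = norm a"
    by (simp add: norm_vec_def norm_mult)
  have "4 * power_levi f c z a = (dderiv (dderiv f a) a z + c / f z * (dderiv f a z)\<^sup>2)
     + (dderiv (dderiv f (\<i> *s a)) (\<i> *s a) z + c / f z * (dderiv f (\<i> *s a) z)\<^sup>2)"
    if "Ck_on 2 S f" for f c
    unfolding power_levi_def Re_levi_diag[OF S(1) that S(3)]
      cmod_vec10_cpx[OF Ck_on_2_differentiable(1)[OF that S(3)]]
    by (simp add: distrib_left add_divide_distrib)
  from this[OF C(2), of "\<eta> - 1"] this[OF C'(2), of "\<eta>' - 1"] line[of a] line[of "\<i> *s a"]
  have "?h * (4 * power_levi \<rho> (\<eta> - 1) z a + 2 * (\<delta> * \<rho> z * (norm a)\<^sup>2)) \<le> 4 * power_levi ?\<rho>' (\<eta>' - 1) z a"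
    unfolding na by (simp add: distrib_left)
  then show ?thesis by (simp add: algebra_simps)
qed

section \<open>Uniform bounds by homogeneity and compactness\<close>

lemma power_levi_scale: "power_levi \<rho> c z (of_real r *s a) = r\<^sup>2 * power_levi \<rho> c z a"
  by (simp add: power_levi_def levi_scale vec10_scale norm_mult power_mult_distrib power2_eq_square algebra_simps)

text \<open>The set of points near which \<open>Q\<close> holds is open, so the compact product has
  a uniform collar inside it; the collar is then used only in the point variable.\<close>

lemma compact_times_sphere_nhd:
  fixes K :: "'a::euclidean_space set" and Q :: "'a \<times> 'b::euclidean_space \<Rightarrow> bool"
  assumes "compact K" "\<And>p a. p \<in> K \<Longrightarrow> \<forall>\<^sub>F x in nhds (p, a). Q x"
  obtains e where "0 < e" "\<And>p z a. p \<in> K \<Longrightarrow> dist p z < e \<Longrightarrow> norm a = 1 \<Longrightarrow> Q (z, a)"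
proof -
  let ?K = "K \<times> sphere (0::'b) 1" and ?O = "{x. \<forall>\<^sub>F y in nhds x. Q y}"
  have "open ?O"
    unfolding open_subopen[of ?O] by (auto simp: eventually_nhds)
  moreover have "compact ?K" by (intro compact_Times assms compact_sphere)
  moreover have "?K \<subseteq> ?O" using assms(2) by auto
  ultimately obtain e where e: "0 < e" "(\<Union>x\<in>?K. ball x e) \<subseteq> ?O"
    using compact_subset_open_imp_ball_epsilon_subset by metis
  have "Q (z, a)" if "p \<in> K" "dist p z < e" "norm a = 1" for p z a
  proof -
    have "(z, a) \<in> ball (p, a) e" "(p, a) \<in> ?K" using that by (simp_all add: dist_Pair_Pair)
    then have "(z, a) \<in> ?O" using e(2) by blast
    then show ?thesis using eventually_nhds_x_imp_x by auto
  qed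
  with e(1) show ?thesis using that by blast
qed

lemma power_levi_bound_near_frontier:
  fixes \<rho> :: "complex^'n::finite \<Rightarrow> real"
  assumes \<Omega>: "open \<Omega>" "bounded \<Omega>" "pseudoconvex \<Omega>" and \<rho>: "defining_function \<Omega> \<rho>"
    and \<eta>: "1 < \<eta>" "eta_admissible \<Omega> \<rho> \<eta>" and \<kappa>: "0 < \<kappa>"
  obtains W where "open W" "frontier \<Omega> \<subseteq> W" "smooth_on W \<rho>" "\<And>z. z \<in> W \<Longrightarrow> \<exists>p\<in>frontier \<Omega>. dist p z < 1"
    "\<And>z a. z \<in> W \<Longrightarrow> z \<notin> closure \<Omega> \<Longrightarrow>
      0 < \<rho> z \<and> - \<kappa> * \<rho> z * (norm a)\<^sup>2 \<le> power_levi \<rho> (\<eta> - 1) z a"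
proof -
  obtain V where V: "open V" "closure \<Omega> \<subseteq> V" "smooth_on V \<rho>" "\<Omega> = {z\<in>V. \<rho> z < 0}"
    "\<forall>p\<in>frontier \<Omega>. frechet_derivative \<rho> (at p) \<noteq> (\<lambda>_. 0)"
    using \<rho> unfolding defining_function_def by blast
  have "compact (frontier \<Omega>)" using \<Omega>(2) by (rule compact_frontier_bounded)
  then obtain e where e: "0 < e"
    "\<And>p z a. p \<in> frontier \<Omega> \<Longrightarrow> dist p z < e \<Longrightarrow> norm (a :: complex^'n) = 1 \<Longrightarrow>
      fst (z, a) \<in> V \<and> (fst (z, a) \<notin> closure \<Omega> \<longrightarrow> 0 < \<rho> (fst (z, a)) \<and>
        - \<kappa> * \<rho> (fst (z, a)) \<le> power_levi \<rho> (\<eta> - 1) (fst (z, a)) (snd (z, a)))"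
    using compact_times_sphere_nhd[OF _ power_levi_bound_local[OF \<Omega>(1,3) V \<eta> \<kappa>]] by metis
  \<comment> \<open>Radius at most 1 keeps \<open>W\<close> in a bounded set independent of
    \<open>e\<close>, so that a norm bound on \<open>W\<close> can be fixed before
    \<open>\<kappa>\<close>.\<close>
  define W where "W = (\<Union>p\<in>frontier \<Omega>. ball p (min e 1))"
  \<comment> \<open>Any unit vector, to read off the assertions that do not involve the vector and
    to cover the case \<open>a = 0\<close>.\<close>
  obtain b :: "complex^'n" where b: "norm b = 1" using vector_choose_size[of 1] by auto
  show ?thesis
  proof
    show "open W" by (auto simp: W_def)
    show "frontier \<Omega> \<subseteq> W" using e(1) by (auto simp: W_def)
    have "W \<subseteq> V" using e(2)[OF _ _ b] by (auto simp: W_def)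
    then show "smooth_on W \<rho>" using V(3) by (rule smooth_on_subset[rotated])
    show "\<exists>p\<in>frontier \<Omega>. dist p z < 1" if "z \<in> W" for z using that by (auto simp: W_def)
    fix z and a :: "complex^'n"
    assume z: "z \<in> W" "z \<notin> closure \<Omega>"
    then obtain p where p: "p \<in> frontier \<Omega>" "dist p z < e" by (auto simp: W_def)
    have unit: "0 < \<rho> z" "- \<kappa> * \<rho> z \<le> power_levi \<rho> (\<eta> - 1) z u" if "norm u = 1" for u
      using e(2)[OF p that] z(2) by auto
    show "0 < \<rho> z \<and> - \<kappa> * \<rho> z * (norm a)\<^sup>2 \<le> power_levi \<rho> (\<eta> - 1) z a"
    proof (cases "a = 0")
      case True
      then show ?thesis using unit(1)[OF b] by (simp add: power_levi_def levi_def vec10_def)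
    next
      case False
      define u where "u = (1 / norm a) *\<^sub>R a"
      have u: "norm u = 1" "a = of_real (norm a) *s u"
        using False by (simp_all add: u_def vec_eq_iff complex_eq_iff)
      have "- \<kappa> * \<rho> z * (norm a)\<^sup>2 \<le> (norm a)\<^sup>2 * power_levi \<rho> (\<eta> - 1) z u"
        using mult_right_mono[OF unit(2)[OF u(1)], of "(norm a)\<^sup>2"] by (simp add: mult.commute)
      also have "\<dots> = power_levi \<rho> (\<eta> - 1) z a"
        using power_levi_scale[of \<rho> "\<eta> - 1" z "norm a" u] u(2) by simp
      finally show ?thesis using unit(1)[OF b] by simp
    qed
  qed
qed

text \<open>The order of choices matters: \<open>\<delta>\<close> depends only on the exponents and
  the size of \<open>\<Omega>\<close>, and then the loss \<open>\<kappa> = \<delta> / 4\<close>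
  determines \<open>W\<close>. The Gaussian gain \<open>\<delta> / 2\<close> exceeds this loss and
  leaves a strict surplus.\<close>

lemma steinness_index_le_of_admissible:
  fixes \<Omega> :: "(complex^'n::finite) set"
  assumes \<Omega>: "open \<Omega>" "bounded \<Omega>" "pseudoconvex \<Omega>" and \<rho>: "defining_function \<Omega> \<rho>"
    and \<eta>: "1 < \<eta>" "eta_admissible \<Omega> \<rho> \<eta>" "\<eta> < \<eta>'"
  shows "steinness_index \<Omega> \<le> ereal \<eta>'"
proof -
  obtain B where B: "0 < B" "\<And>z. z \<in> closure \<Omega> \<Longrightarrow> norm z \<le> B"
    using bounded_closure[OF \<Omega>(2)] bounded_pos by metis
  \<comment> \<open>\<open>B\<close> bounds the closure of \<open>\<Omega>\<close> and
    \<open>W\<close> will stay within distance 1 of the frontier. The next line takes the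
    \<open>\<delta>\<close> that gives equality in the smallness hypothesis of
    \<open>power_levi_mult_gaussian\<close>.\<close>
  define R where "R = B + 1"
  define \<delta> where "\<delta> = (\<eta>' - \<eta>) / (4 * \<eta>'\<^sup>2 * R\<^sup>2)"
  have R: "0 < R" and \<eta>': "0 < \<eta>'" using B \<eta> by (simp_all add: R_def)
  then have \<delta>: "0 < \<delta>" "4 * \<eta>'\<^sup>2 * R\<^sup>2 * \<delta> \<le> \<eta>' - \<eta>" using \<eta> by (simp_all add: \<delta>_def)
  then have "0 < \<delta> / 4" by simp
  from power_levi_bound_near_frontier[OF \<Omega> \<rho> \<eta>(1,2) this]
  obtain W where W: "open W" "frontier \<Omega> \<subseteq> W" "smooth_on W \<rho>"
    "\<And>z. z \<in> W \<Longrightarrow> \<exists>p\<in>frontier \<Omega>. dist p z < 1"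
    and bd: "\<And>z a. z \<in> W \<Longrightarrow> z \<notin> closure \<Omega> \<Longrightarrow>
      0 < \<rho> z \<and> - (\<delta> / 4) * \<rho> z * (norm a)\<^sup>2 \<le> power_levi \<rho> (\<eta> - 1) z a" by metis
  let ?\<rho>' = "\<lambda>z. \<rho> z * exp (\<delta> * (z \<bullet> z))" and ?S = "- closure \<Omega> \<inter> W"
  have S: "open ?S" using W(1) by (simp add: open_Int open_Compl)
  have s: "smooth_on ?S \<rho>" using W(3) by (rule smooth_on_subset) simp
  have sE: "smooth_on ?S (\<lambda>y. exp (\<delta> * (y \<bullet> y)))"
    by (rule smooth_on_subset[OF gaussian_derivatives(1)]) simp
  have pos: "0 < ?\<rho>' z" if "z \<in> ?S" for z using bd that by simp
  have "strictly_psh_on ?S (\<lambda>z. ?\<rho>' z powr \<eta>')"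
    unfolding strictly_psh_on_def
  proof (intro conjI ballI allI impI)
    show "Ck_on 2 ?S (\<lambda>z. ?\<rho>' z powr \<eta>')"
      by (intro smooth_on_imp_Ck_on smooth_on_powr[OF S smooth_on_mult[OF S s sE] pos])
    fix z and a :: "complex^'n" assume z: "z \<in> ?S" and a: "a \<noteq> 0"
    have p: "0 < \<rho> z" "- (\<delta> / 4) * \<rho> z * (norm a)\<^sup>2 \<le> power_levi \<rho> (\<eta> - 1) z a"
      using bd z by auto
    obtain q where q: "q \<in> frontier \<Omega>" "dist q z < 1" using W(4) z by blast
    have "norm z \<le> norm q + dist q z"
      using norm_triangle_ineq[of q "z - q"] by (simp add: dist_norm norm_minus_commute)
    also have "\<dots> \<le> R" using B(2)[of q] q by (simp add: R_def frontier_def)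
    finally have "norm z \<le> R" .
    note main = power_levi_mult_gaussian[OF S s z p(1) \<eta>(1,3) \<delta> this, of a]
    have "0 < \<delta> / 4 * \<rho> z * (norm a)\<^sup>2" using \<delta> p(1) a by simp
    then have "0 < power_levi \<rho> (\<eta> - 1) z a + \<delta> / 2 * \<rho> z * (norm a)\<^sup>2" using p(2) by simp
    then have "0 < exp (\<delta> * (z \<bullet> z)) * (power_levi \<rho> (\<eta> - 1) z a + \<delta> / 2 * \<rho> z * (norm a)\<^sup>2)"
      by simp
    with main have "0 < power_levi ?\<rho>' (\<eta>' - 1) z a" by linarith
    moreover have "?\<rho>' z \<noteq> 0" using pos[OF z] by linarith
    then have "0 < ?\<rho>' z powr (\<eta>' - 1)" by (rule powr_gt_zero[THEN iffD2])
    moreover have "Re (levi (\<lambda>z. ?\<rho>' z powr \<eta>') z a a)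
        = \<eta>' * ?\<rho>' z powr (\<eta>' - 1) * power_levi ?\<rho>' (\<eta>' - 1) z a"
      by (rule Re_levi_powr[OF S smooth_on_mult[OF S s sE] z]) (rule pos)
    ultimately show "0 < Re (levi (\<lambda>z. ?\<rho>' z powr \<eta>') z a a)"
      using \<eta>' by (simp only: mult_pos_pos)
  qed
  then have "steinness_exponent \<Omega> ?\<rho>' \<le> ereal \<eta>'"
    unfolding steinness_exponent_def using W(1,2) \<eta>
    by (intro Inf_lower imageI CollectI conjI exI[of _ W]) auto
  moreover have "steinness_index \<Omega> \<le> steinness_exponent \<Omega> ?\<rho>'"
    unfolding steinness_index_def
    by (intro INF_lower CollectI defining_function_mult_gaussian \<Omega> \<rho>)
  ultimately show ?thesis by (rule order.trans[rotated])
qed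

theorem theorem3p1:
  fixes \<Omega> :: "(complex^'n::finite) set"
  assumes "CARD('n) \<ge> 2"
    and "open \<Omega>" and "connected \<Omega>" and "\<Omega> \<noteq> {}"
    and "bounded \<Omega>"
    and "smooth_boundary \<Omega>"
    and "pseudoconvex \<Omega>"
  shows "steinness_index \<Omega> = (INF \<rho>\<in>{\<rho>. defining_function \<Omega> \<rho>}. eta_exponent \<Omega> \<rho>)"
proof (rule antisym)
  show "steinness_index \<Omega> \<le> (INF \<rho>\<in>{\<rho>. defining_function \<Omega> \<rho>}. eta_exponent \<Omega> \<rho>)"
  proof (rule INF_greatest)
    fix \<rho> assume "\<rho> \<in> {\<rho>. defining_function \<Omega> \<rho>}"
    then have \<rho>: "defining_function \<Omega> \<rho>" by simp
    show "steinness_index \<Omega> \<le> eta_exponent \<Omega> \<rho>"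
      unfolding eta_exponent_def
    proof (rule Inf_greatest)
      fix x assume "x \<in> ereal ` {\<eta>. 1 < \<eta> \<and> eta_admissible \<Omega> \<rho> \<eta>}"
      then obtain \<eta> where \<eta>: "x = ereal \<eta>" "1 < \<eta>" "eta_admissible \<Omega> \<rho> \<eta>" by blast
      show "steinness_index \<Omega> \<le> x"
      \<comment> \<open>Only exponents strictly above an admissible one are reached, so the bound by
        the admissible exponent itself comes from density.\<close>
      proof (rule dense_ge)
        fix y assume "x < y"
        then show "steinness_index \<Omega> \<le> y"
          using steinness_index_le_of_admissible[OF assms(2,5,7) \<rho> \<eta>(2,3)] \<eta>(1) by (cases y) auto
      qed
    qed
  qed
  show "(INF \<rho>\<in>{\<rho>. defining_function \<Omega> \<rho>}. eta_exponent \<Omega> \<rho>) \<le> steinness_index \<Omega>"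
    unfolding steinness_index_def
  proof (rule INF_mono)
    fix \<rho> assume "\<rho> \<in> {\<rho>. defining_function \<Omega> \<rho>}"
    then have "eta_exponent \<Omega> \<rho> \<le> steinness_exponent \<Omega> \<rho>"
      unfolding eta_exponent_def steinness_exponent_def
      using eta_admissible_if_power_psh[OF assms(2)] by (intro Inf_superset_mono image_mono) blast
    then show "\<exists>\<rho>'\<in>{\<rho>. defining_function \<Omega> \<rho>}. eta_exponent \<Omega> \<rho>' \<le> steinness_exponent \<Omega> \<rho>"
      using \<open>\<rho> \<in> _\<close> by blast
  qed
qed

end
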